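(* Let $S=k[x_1,\ldots,x_n]$ be a polynomial ring over a field $k$. Let $I=(L(u,v))\subset S$ be a lexsegment edge ideal where $u=x_1x_i$, $v=x_jx_r$ ($1<i\le n$, $j<r\le n$) and $j\geq 2$. Then $$\mathrm{reg}(I)=\begin{cases}3, & \text{if } i\geq j+2 \text{ and } x_n\nmid v,\\ 2, & \text{otherwise.}\end{cases}$$
   Context: Monomials are ordered by the lexicographic order with $x_1>x_2>\cdots>x_n$. For squarefree monomials $u\geq_{lex}v$ of degree $2$, $L(u,v)=\{w: w \text{ a squarefree monomial of degree } 2,\ u\geq_{lex}w\geq_{lex}v\}$, and the ideal $(L(u,v))$ is called the lexsegment edge ideal determined by $u,v$. $\mathrm{reg}(I)$ is the Castelnuovo–Mumford regularity of $I$ as a graded $S$-module: $\mathrm{reg}(I)=\max\{j:\beta_{i,i+j}(I)\neq0\text{ for some }i\}$, where $\beta_{i,j}$ are the graded Betti numbers. *)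

theory Defs
  imports "HOL-Library.Poly_Mapping" "Jordan_Normal_Form.Matrix"
begin

text \<open>A monomial is given by its exponent vector, so products of monomials are written
  additively. The polynomial ring \<open>k[x\<^sub>1,\<dots>,x\<^sub>n]\<close> is the subring \<open>poly_ring n\<close> of the ring of
  polynomials in the variables \<open>x\<^sub>0, x\<^sub>1, x\<^sub>2, \<dots>\<close>.\<close>

type_synonym monomial = "nat \<Rightarrow>\<^sub>0 nat"
type_synonym 'k mpoly = "monomial \<Rightarrow>\<^sub>0 'k"

definition X :: "nat \<Rightarrow> monomial" where
  "X i = Poly_Mapping.single i 1"

definition monomials :: "nat \<Rightarrow> monomial set" where
  "monomials n = {w. Poly_Mapping.keys w \<subseteq> {1..n}}"

definition mdeg :: "monomial \<Rightarrow> nat" where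
  "mdeg w = (\<Sum>i\<in>Poly_Mapping.keys w. Poly_Mapping.lookup w i)"

definition squarefree_monomial :: "monomial \<Rightarrow> bool" where
  "squarefree_monomial w \<longleftrightarrow> (\<forall>i. Poly_Mapping.lookup w i \<le> 1)"

definition mono_dvd :: "monomial \<Rightarrow> monomial \<Rightarrow> bool" where
  "mono_dvd s t \<longleftrightarrow> (\<exists>w. t = s + w)"

text \<open>The library's linear order on \<^typ>\<open>monomial\<close> is the lexicographic order with
  \<open>x\<^sub>1 > x\<^sub>2 > \<dots> > x\<^sub>n\<close>:\<close>

lemma less_monomial_iff:
  fixes v w :: monomial
  shows "v < w \<longleftrightarrow>
    (\<exists>k. Poly_Mapping.lookup v k < Poly_Mapping.lookup w k \<and>
         (\<forall>l<k. Poly_Mapping.lookup v l = Poly_Mapping.lookup w l))"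
  by (transfer, simp add: less_fun_def)

definition lexsegment :: "nat \<Rightarrow> monomial \<Rightarrow> monomial \<Rightarrow> monomial set" where
  "lexsegment n u v =
    {w \<in> monomials n. squarefree_monomial w \<and> mdeg w = 2 \<and> u \<ge> w \<and> w \<ge> v}"

definition poly_ring :: "nat \<Rightarrow> 'k::zero mpoly set" where
  "poly_ring n = {p. Poly_Mapping.keys p \<subseteq> monomials n}"

definition ideal_generated :: "nat \<Rightarrow> 'k::field mpoly set \<Rightarrow> 'k mpoly set" where
  "ideal_generated n G =
    {\<Sum>g\<in>T. c g * g | T c. finite T \<and> T \<subseteq> G \<and> (\<forall>g\<in>T. c g \<in> poly_ring n)}"

definition monomial_ideal :: "nat \<Rightarrow> monomial set \<Rightarrow> 'k::field mpoly set" where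
  "monomial_ideal n L = ideal_generated n ((\<lambda>w. Poly_Mapping.single w 1) ` L)"

definition homogeneous :: "int \<Rightarrow> 'k::zero mpoly \<Rightarrow> bool" where
  "homogeneous a p \<longleftrightarrow> (\<forall>w\<in>Poly_Mapping.keys p. int (mdeg w) = a)"

text \<open>A list \<open>[a\<^sub>1,\<dots>,a\<^sub>b]\<close> of integers stands for the graded free module
  \<open>S(-a\<^sub>1) \<oplus> \<dots> \<oplus> S(-a\<^sub>b)\<close>, whose basis elements have degrees \<open>a\<^sub>1,\<dots>,a\<^sub>b\<close>.\<close>

definition free_module :: "nat \<Rightarrow> int list \<Rightarrow> 'k::field mpoly vec set" where
  "free_module n as = {f \<in> carrier_vec (length as). \<forall>s<length as. f $ s \<in> poly_ring n}"

text \<open>The matrices of the homogeneous maps of degree 0 from the free module of \<open>as\<close> to that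
  of \<open>bs\<close>.\<close>

definition graded_maps :: "nat \<Rightarrow> int list \<Rightarrow> int list \<Rightarrow> 'k::field mpoly mat set" where
  "graded_maps n as bs =
    {A \<in> carrier_mat (length bs) (length as).
      \<forall>t<length bs. \<forall>s<length as.
        A $$ (t, s) \<in> poly_ring n \<and> homogeneous (as ! s - bs ! t) (A $$ (t, s))}"

text \<open>The complex \<open>\<dots> \<rightarrow> F\<^sub>2 \<rightarrow> F\<^sub>1 \<rightarrow> F\<^sub>0 \<rightarrow> I \<rightarrow> 0\<close>, where \<open>F\<^sub>i\<close> is the free module of \<open>d i\<close>: the matrix
  \<open>D (i + 1)\<close> is the differential \<open>F\<^bsub>i+1\<^esub> \<rightarrow> F\<^sub>i\<close>, and the row matrix \<open>D 0\<close> is the augmentation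
  \<open>F\<^sub>0 \<rightarrow> I \<subseteq> S\<close>. Minimality says that the differentials have their entries in
  \<open>(x\<^sub>1,\<dots>,x\<^sub>n)\<close>, that is, have no constant terms.\<close>

definition minimal_graded_free_resolution ::
  "nat \<Rightarrow> 'k::field mpoly set \<Rightarrow> (nat \<Rightarrow> int list) \<times> (nat \<Rightarrow> 'k mpoly mat) \<Rightarrow> bool" where
  "minimal_graded_free_resolution n I = (\<lambda>(d, D).
     D 0 \<in> graded_maps n (d 0) [0] \<and>
     (\<forall>i. D (Suc i) \<in> graded_maps n (d (Suc i)) (d i)) \<and>
     (\<lambda>f. (D 0 *\<^sub>v f) $ 0) ` free_module n (d 0) = I \<and>
     (\<forall>i. (\<lambda>f. D (Suc i) *\<^sub>v f) ` free_module n (d (Suc i)) =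
          {f \<in> free_module n (d i). D i *\<^sub>v f = 0\<^sub>v (dim_row (D i))}) \<and>
     (\<forall>i. \<forall>t<length (d i). \<forall>s<length (d (Suc i)).
        Poly_Mapping.lookup (D (Suc i) $$ (t, s)) 0 = 0))"

text \<open>The choice of the resolution is immaterial: a homogeneous ideal has a minimal graded free
  resolution, which is unique up to isomorphism.\<close>

definition graded_betti :: "nat \<Rightarrow> 'k::field mpoly set \<Rightarrow> nat \<Rightarrow> int \<Rightarrow> nat" where
  "graded_betti n I i a =
    count_list (fst (SOME R. minimal_graded_free_resolution n I R) i) a"

definition regularity :: "nat \<Rightarrow> 'k::field mpoly set \<Rightarrow> int" where
  "regularity n I = Max {j. \<exists>i. graded_betti n I i (int i + j) \<noteq> 0}"

end

theory Submission
  imports Defs "HOL-Library.Product_Plus"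
begin

text \<open>The minimal resolution of the ideal is built by adding the generators one at a time. If \<open>J\<close> is the
  ideal generated so far and \<open>m\<close> is the next generator, then multiplication by \<open>m\<close> embeds \<open>S/(J : m)\<close>, up to
  a shift of degrees, into \<open>S/J\<close> with cokernel \<open>S/(J + (m))\<close>, and the mapping cone of a lift of this embedding
  resolves the cokernel (\<open>mapping_cone\<close>). The cone is minimal if, after the shift, the two
  resolutions have no common degree in the same homological position.

  The generators without \<open>x\<^sub>1\<close> are added in lexicographic order, then \<open>x\<^sub>1 x\<^sub>i, x\<^sub>1 x\<^bsub>i+1\<^esub>, \<dots>, x\<^sub>1 x\<^sub>n\<close>. As long as
  all colon ideals are generated by variables, the shifted resolutions are Koszul complexes,
  the resolution stays linear, and the regularity is 2. This is the case unless \<open>i \<ge> j + 2\<close> and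
  \<open>r < n\<close> (\<open>segment_edges_linearly_resolved\<close>).

  If \<open>i \<ge> j + 2\<close> and \<open>r < n\<close>, then \<open>x\<^sub>1 x\<^sub>n\<close> and \<open>x\<^sub>j x\<^bsub>j+1\<^esub>\<close> are two edges of the graph that no third edge joins, and
  their Koszul syzygy of degree 4 is not a combination of linear ones. In the construction this
  shows as follows: for \<open>b > r\<close> the colon ideal by \<open>x\<^sub>1 x\<^sub>b\<close> is generated by variables and by the products \<open>x\<^sub>j x\<^sub>y\<close>
  with \<open>j < y \<le> r\<close> and \<open>y < i\<close>. Its resolution has degrees on the linear strand and on the next one, so
  the regularity is at most 3, and it is 3 if the generators \<open>x\<^sub>j x\<^sub>y\<close> survive in the cone. The
  total degree alone does not exclude cancellation. Therefore the resolutions are graded by the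
  pair of the total degree and the exponent of \<open>x\<^sub>j\<close>: this exponent is 1 on the second strand of the resolution
  so far, and 0 on the strand that could cancel against it
  (\<open>almost_linearly_resolved_insert\<close>).

  Regularity refers to an arbitrarily chosen minimal resolution. The degrees in it are those of
  the constructed one because a minimal resolution is a direct summand of every other
  resolution (\<open>minimal_degrees_subset\<close>).\<close>

section \<open>Monomials and constant terms\<close>

lemma keys_add_monomial:
  fixes v w :: monomial
  shows "Poly_Mapping.keys (v + w) = Poly_Mapping.keys v \<union> Poly_Mapping.keys w"
  by (auto simp: in_keys_iff lookup_add)

lemma add_in_monomials_iff: "v + w \<in> monomials n \<longleftrightarrow> v \<in> monomials n \<and> w \<in> monomials n"
  by (auto simp: monomials_def keys_add_monomial)

lemma zero_in_monomials [simp]: "0 \<in> monomials n"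
  by (simp add: monomials_def)

lemma monomial_sum_eq_0_iff:
  fixes v w :: monomial
  shows "v + w = 0 \<longleftrightarrow> v = 0 \<and> w = 0"
  by (metis Un_empty keys_add_monomial keys_eq_empty add_0)

lemma poly_ring_0 [simp]: "0 \<in> poly_ring n"
  by (simp add: poly_ring_def)

lemma poly_ring_single: "w \<in> monomials n \<Longrightarrow> Poly_Mapping.single w c \<in> poly_ring n"
  by (auto simp: poly_ring_def)

lemma poly_ring_1 [simp]: "(1 :: 'k::field mpoly) \<in> poly_ring n"
  by (simp add: poly_ring_def)

lemma poly_ring_add: "p \<in> poly_ring n \<Longrightarrow> q \<in> poly_ring n \<Longrightarrow> p + q \<in> poly_ring n"
  for p q :: "'k::field mpoly"
  using Poly_Mapping.keys_add[of p q] by (auto simp: poly_ring_def)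

lemma poly_ring_uminus: "p \<in> poly_ring n \<Longrightarrow> - p \<in> poly_ring n" for p :: "'k::field mpoly"
  by (auto simp: poly_ring_def in_keys_iff subset_iff)

lemma poly_ring_mult: "p \<in> poly_ring n \<Longrightarrow> q \<in> poly_ring n \<Longrightarrow> p * q \<in> poly_ring n"
  for p q :: "'k::field mpoly"
  using Poly_Mapping.keys_mult[of p q] by (fastforce simp: poly_ring_def add_in_monomials_iff)

lemma poly_ring_sum: "(\<And>x. x \<in> A \<Longrightarrow> f x \<in> poly_ring n) \<Longrightarrow> sum f A \<in> poly_ring n"
  for f :: "_ \<Rightarrow> 'k::field mpoly"
  by (induction A rule: infinite_finite_induct) (auto intro: poly_ring_add)

text \<open>Taking the constant term is reduction modulo the ideal generated by the variables, hence
  multiplicative. A matrix without constant terms is one that vanishes modulo this ideal.\<close>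

lemma const_term_mult:
  fixes p q :: "'k::field mpoly"
  shows "Poly_Mapping.lookup (p * q) 0 = Poly_Mapping.lookup p 0 * Poly_Mapping.lookup q 0"
proof -
  have "Poly_Mapping.lookup (p * q) 0 =
      Sum_any (\<lambda>l. Poly_Mapping.lookup p l * Sum_any (\<lambda>q'. Poly_Mapping.lookup q q' when 0 = l + q'))"
    by (simp add: lookup_mult)
  also have "\<dots> = Sum_any (\<lambda>l. (Poly_Mapping.lookup p l * Poly_Mapping.lookup q 0) when l = 0)"
  proof (rule Sum_any.cong)
    fix l :: monomial
    show "Poly_Mapping.lookup p l * Sum_any (\<lambda>q'. Poly_Mapping.lookup q q' when 0 = l + q') =
      ((Poly_Mapping.lookup p l * Poly_Mapping.lookup q 0) when l = 0)"
    proof (cases "l = 0")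
      case False
      then have "(0 = l + q') = False" for q'
        using monomial_sum_eq_0_iff[of l q'] by metis
      then show ?thesis using False by simp
    next
      case True
      then have "(0 = l + q') = (q' = 0)" for q' by auto
      then show ?thesis using True by simp
    qed
  qed
  finally show ?thesis by simp
qed

section \<open>Homogeneous components in an arbitrary grading\<close>

text \<open>Two gradings are needed: by total degree, in which regularity is defined, and by the pair of
  the total degree and the exponent of one chosen variable, in which the minimality of the
  resolution becomes visible. The grading group is therefore left arbitrary.\<close>

locale grading =
  fixes n :: nat and deg :: "monomial \<Rightarrow> 'g::ab_group_add"
  assumes deg_add: "deg (v + w) = deg v + deg w"
begin

lemma deg_0 [simp]: "deg 0 = 0"
  using deg_add[of 0 0] by simp

definition homog :: "'g \<Rightarrow> 'k::field mpoly \<Rightarrow> bool" where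
  "homog a p \<longleftrightarrow> (\<forall>w\<in>Poly_Mapping.keys p. deg w = a)"

definition component :: "'g \<Rightarrow> 'k::field mpoly \<Rightarrow> 'k mpoly" where
  "component a p = Poly_Mapping.mapp (\<lambda>w c. c when deg w = a) p"

lemma lookup_component:
  "Poly_Mapping.lookup (component a p) w = (Poly_Mapping.lookup p w when deg w = a)"
  by (simp add: component_def lookup_mapp when_def in_keys_iff)

lemma homog_0 [simp]: "homog a 0"
  by (simp add: homog_def)

lemma homog_1: "homog 0 1"
  by (simp add: homog_def)

lemma homog_add: "homog a p \<Longrightarrow> homog a q \<Longrightarrow> homog a (p + q)"
  using Poly_Mapping.keys_add[of p q] by (auto simp: homog_def)

lemma homog_uminus: "homog a p \<Longrightarrow> homog a (- p)"
  by (auto simp: homog_def in_keys_iff)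

lemma homog_sum: "(\<And>x. x \<in> A \<Longrightarrow> homog a (f x)) \<Longrightarrow> homog a (sum f A)"
  by (induction A rule: infinite_finite_induct) (auto intro: homog_add)

lemma homog_mult:
  assumes "homog a p" "homog b q"
  shows "homog (a + b) (p * q)"
  using assms Poly_Mapping.keys_mult[of p q] by (fastforce simp: homog_def deg_add)

lemma homog_const_term: "homog a p \<Longrightarrow> Poly_Mapping.lookup p 0 \<noteq> 0 \<Longrightarrow> a = 0"
  by (force simp: homog_def in_keys_iff)

lemma homog_component: "homog a (component a p)"
  by (auto simp: homog_def in_keys_iff lookup_component)

lemma component_in_poly_ring: "p \<in> poly_ring n \<Longrightarrow> component a p \<in> poly_ring n"
  by (auto simp: poly_ring_def in_keys_iff lookup_component subset_iff)

lemma component_homog: "homog a p \<Longrightarrow> component a p = p"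
  by (rule poly_mapping_eqI) (auto simp: homog_def in_keys_iff lookup_component when_def)

lemma component_add: "component a (p + q) = component a p + component a q"
  by (rule poly_mapping_eqI) (auto simp: lookup_add lookup_component when_def)

lemma component_0 [simp]: "component a 0 = 0"
  by (rule poly_mapping_eqI) (auto simp: lookup_component)

lemma component_sum: "component a (sum f A) = (\<Sum>x\<in>A. component a (f x))"
  by (induction A rule: infinite_finite_induct) (auto simp: component_add)

text \<open>Splitting off one homogeneous component is what turns an arbitrary preimage under a graded
  map into a homogeneous one.\<close>

lemma component_homog_mult:
  assumes "homog a p"
  shows "component (a + b) (p * q) = p * component b q"
proof -
  have main: "component (a + b) (p * component b q) = p * component b q"
    by (rule component_homog[OF homog_mult[OF assms homog_component]])
  have rest: "component (a + b) (p * (q - component b q)) = 0"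
  proof (rule poly_mapping_eqI)
    fix w
    show "Poly_Mapping.lookup (component (a + b) (p * (q - component b q))) w = Poly_Mapping.lookup 0 w"
    proof (rule ccontr)
      assume "Poly_Mapping.lookup (component (a + b) (p * (q - component b q))) w \<noteq> Poly_Mapping.lookup 0 w"
      then have d: "deg w = a + b" and "w \<in> Poly_Mapping.keys (p * (q - component b q))"
        by (auto simp: lookup_component when_def in_keys_iff split: if_splits)
      then obtain v v' where "w = v + v'" "v \<in> Poly_Mapping.keys p"
        "v' \<in> Poly_Mapping.keys (q - component b q)"
        using Poly_Mapping.keys_mult[of p "q - component b q"] by blast
      moreover from this have "deg v' \<noteq> b"
        by (auto simp: in_keys_iff lookup_minus lookup_component)
      ultimately show False using assms d by (simp add: deg_add homog_def)
    qed
  qed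
  have "component (a + b) (p * q) =
      component (a + b) (p * component b q + p * (q - component b q))"
    by (simp add: algebra_simps)
  also have "\<dots> = p * component b q"
    unfolding component_add main rest by simp
  finally show ?thesis .
qed

end

section \<open>Matrices over the polynomial ring\<close>

lemma index_mult_mat_sum:
  assumes "A \<in> carrier_mat r m" "B \<in> carrier_mat m c" "t < r" "s < c"
  shows "(A * B) $$ (t, s) = (\<Sum>k<m. A $$ (t, k) * B $$ (k, s))"
  using assms by (auto simp: scalar_prod_def lessThan_atLeast0 intro!: sum.cong)

lemma index_mult_vec_sum:
  assumes "A \<in> carrier_mat r m" "f \<in> carrier_vec m" "t < r"
  shows "(A *\<^sub>v f) $ t = (\<Sum>k<m. A $$ (t, k) * f $ k)"
  using assms by (auto simp: scalar_prod_def lessThan_atLeast0 intro!: sum.cong)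

definition poly_vecs :: "nat \<Rightarrow> nat \<Rightarrow> 'k::field mpoly vec set" where
  "poly_vecs n m = {f \<in> carrier_vec m. \<forall>s<m. f $ s \<in> poly_ring n}"

definition poly_mats :: "nat \<Rightarrow> nat \<Rightarrow> nat \<Rightarrow> 'k::field mpoly mat set" where
  "poly_mats n r c = {A \<in> carrier_mat r c. \<forall>t<r. \<forall>s<c. A $$ (t, s) \<in> poly_ring n}"

lemma free_module_eq_poly_vecs: "free_module n as = poly_vecs n (length as)"
  by (simp add: free_module_def poly_vecs_def)

lemma poly_vecs_carrier: "f \<in> poly_vecs n m \<Longrightarrow> f \<in> carrier_vec m"
  by (simp add: poly_vecs_def)

lemma poly_mats_carrier: "A \<in> poly_mats n r c \<Longrightarrow> A \<in> carrier_mat r c"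
  by (simp add: poly_mats_def)

lemma poly_mats_mult_vec:
  "A \<in> poly_mats n r m \<Longrightarrow> f \<in> poly_vecs n m \<Longrightarrow> A *\<^sub>v f \<in> poly_vecs n r"
  by (auto simp: poly_mats_def poly_vecs_def index_mult_vec_sum simp del: index_mult_mat_vec
      intro!: poly_ring_sum poly_ring_mult)

lemma poly_mats_mult:
  "A \<in> poly_mats n r m \<Longrightarrow> B \<in> poly_mats n m c \<Longrightarrow> A * B \<in> poly_mats n r c"
  by (auto simp: poly_mats_def index_mult_mat_sum simp del: index_mult_mat(1)
      intro!: poly_ring_sum poly_ring_mult)

lemma poly_mats_minus:
  "A \<in> poly_mats n r c \<Longrightarrow> B \<in> poly_mats n r c \<Longrightarrow> A - B \<in> poly_mats n r c"
  by (auto simp: poly_mats_def poly_ring_add poly_ring_uminus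
      simp del: add_uminus_conv_diff simp add: diff_conv_add_uminus)

lemma poly_mats_col: "A \<in> poly_mats n r c \<Longrightarrow> s < c \<Longrightarrow> col A s \<in> poly_vecs n r"
  by (auto simp: poly_mats_def poly_vecs_def)

lemma unit_vec_in_poly_vecs: "unit_vec m s \<in> poly_vecs n m"
  by (auto simp: poly_vecs_def unit_vec_def)

lemma poly_mats_zero: "0\<^sub>m r c \<in> poly_mats n r c"
  by (auto simp: poly_mats_def)

lemma poly_mats_one: "1\<^sub>m r \<in> poly_mats n r r"
  by (auto simp: poly_mats_def)

lemma lift_columns:
  fixes D :: "'k::field mpoly mat"
  assumes D: "D \<in> poly_mats n r m" and M: "M \<in> carrier_mat r c"
    and cols: "\<And>s. s < c \<Longrightarrow> col M s \<in> (*\<^sub>v) D ` poly_vecs n m"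
  shows "\<exists>N\<in>poly_mats n m c. D * N = M"
proof -
  have "\<forall>s. \<exists>g. s < c \<longrightarrow> g \<in> poly_vecs n m \<and> col M s = D *\<^sub>v g"
    using cols by blast
  then obtain g where g: "\<And>s. s < c \<Longrightarrow> g s \<in> poly_vecs n m"
    "\<And>s. s < c \<Longrightarrow> col M s = D *\<^sub>v g s" by metis
  define N where "N = mat m c (\<lambda>(t, s). g s $ t)"
  have N: "N \<in> poly_mats n m c"
    using g(1) by (auto simp: N_def poly_mats_def poly_vecs_def)
  have colN: "col N s = g s" if "s < c" for s
    using g(1)[OF that] that by (auto simp: N_def poly_vecs_def)
  have "D * N = M"
  proof (rule mat_col_eqI)
    show "col (D * N) s = col M s" if "s < dim_col M" for s
      using that M colN g(2) col_mult2[OF poly_mats_carrier[OF D] poly_mats_carrier[OF N]] by auto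
  qed (use D N M in \<open>auto simp: poly_mats_def\<close>)
  with N show ?thesis by blast
qed

definition no_const_terms :: "'k::field mpoly mat \<Rightarrow> bool" where
  "no_const_terms A \<longleftrightarrow>
    (\<forall>t<dim_row A. \<forall>s<dim_col A. Poly_Mapping.lookup (A $$ (t, s)) 0 = 0)"

lemma no_const_terms_mult_left:
  assumes "no_const_terms A" "A \<in> carrier_mat r m" "B \<in> carrier_mat m c"
  shows "no_const_terms (A * B)"
  using assms by (auto simp: no_const_terms_def index_mult_mat_sum lookup_sum const_term_mult
      simp del: index_mult_mat(1))

lemma no_const_terms_mult_right:
  assumes "no_const_terms B" "A \<in> carrier_mat r m" "B \<in> carrier_mat m c"
  shows "no_const_terms (A * B)"
  using assms by (auto simp: no_const_terms_def index_mult_mat_sum lookup_sum const_term_mult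
      simp del: index_mult_mat(1))

section \<open>Graded maps and resolutions\<close>

context grading
begin

definition gmaps :: "'g list \<Rightarrow> 'g list \<Rightarrow> 'k::field mpoly mat set" where
  "gmaps as bs = {A \<in> poly_mats n (length bs) (length as).
     \<forall>t<length bs. \<forall>s<length as. homog (as ! s - bs ! t) (A $$ (t, s))}"

lemma gmaps_poly_mats: "A \<in> gmaps as bs \<Longrightarrow> A \<in> poly_mats n (length bs) (length as)"
  by (simp add: gmaps_def)

lemma gmaps_carrier: "A \<in> gmaps as bs \<Longrightarrow> A \<in> carrier_mat (length bs) (length as)"
  by (simp add: gmaps_def poly_mats_def)

lemma gmaps_mult:
  assumes A: "A \<in> gmaps bs cs" and B: "B \<in> gmaps as bs"
  shows "A * B \<in> gmaps as cs"
proof -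
  have "homog (as ! s - cs ! t) ((A * B) $$ (t, s))" if "t < length cs" "s < length as" for t s
  proof -
    have "homog (as ! s - cs ! t) (A $$ (t, k) * B $$ (k, s))" if "k < length bs" for k
      using homog_mult[of "bs ! k - cs ! t" "A $$ (t, k)" "as ! s - bs ! k" "B $$ (k, s)"]
        A B that \<open>t < length cs\<close> \<open>s < length as\<close> by (simp add: gmaps_def)
    then show ?thesis
      by (simp only: index_mult_mat_sum[OF gmaps_carrier[OF A] gmaps_carrier[OF B] that])
        (auto intro: homog_sum)
  qed
  then show ?thesis
    using poly_mats_mult[OF gmaps_poly_mats[OF A] gmaps_poly_mats[OF B]] by (simp add: gmaps_def)
qed

lemma gmaps_one: "1\<^sub>m (length as) \<in> gmaps as as"
  by (auto simp: gmaps_def poly_mats_one homog_1)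

lemma gmaps_zero: "0\<^sub>m (length bs) (length as) \<in> gmaps as bs"
  by (auto simp: gmaps_def poly_mats_zero)

lemma gmaps_const_term:
  assumes "A \<in> gmaps as bs" "t < length bs" "s < length as"
    "Poly_Mapping.lookup (A $$ (t, s)) 0 \<noteq> 0"
  shows "as ! s = bs ! t"
  using assms homog_const_term[of "as ! s - bs ! t" "A $$ (t, s)"] by (simp add: gmaps_def)

text \<open>This is the projectivity of graded free modules: lift the basis elements one by one, and then
  discard the components of the preimages that have the wrong degree.\<close>

lemma graded_lift_columns:
  assumes D: "D \<in> gmaps cs bs" and M: "M \<in> gmaps as bs"
    and cols: "\<And>s. s < length as \<Longrightarrow> col M s \<in> (*\<^sub>v) D ` poly_vecs n (length cs)"
  shows "\<exists>N\<in>gmaps as cs. D * N = M"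
proof -
  obtain N where N: "N \<in> poly_mats n (length cs) (length as)" and DN: "D * N = M"
    using lift_columns[OF gmaps_poly_mats[OF D] gmaps_carrier[OF M] cols] by blast
  define N' where
    "N' = mat (length cs) (length as) (\<lambda>(t, s). component (as ! s - cs ! t) (N $$ (t, s)))"
  have N': "N' \<in> gmaps as cs"
    using N by (auto simp: N'_def gmaps_def poly_mats_def component_in_poly_ring homog_component)
  have "D * N' = M"
  proof (rule eq_matI)
    fix t s assume "t < dim_row M" "s < dim_col M"
    then have t: "t < length bs" and s: "s < length as"
      using gmaps_carrier[OF M] by auto
    have "(D * N') $$ (t, s) = (\<Sum>k<length cs. D $$ (t, k) * N' $$ (k, s))"
      by (rule index_mult_mat_sum[OF gmaps_carrier[OF D] gmaps_carrier[OF N'] t s])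
    also have "\<dots> = (\<Sum>k<length cs. component (as ! s - bs ! t) (D $$ (t, k) * N $$ (k, s)))"
    proof (rule sum.cong)
      fix k assume "k \<in> {..<length cs}"
      then have "homog (cs ! k - bs ! t) (D $$ (t, k))" and k: "k < length cs"
        using D t by (auto simp: gmaps_def)
      from component_homog_mult[OF this(1), of "as ! s - cs ! k" "N $$ (k, s)"]
      show "D $$ (t, k) * N' $$ (k, s) = component (as ! s - bs ! t) (D $$ (t, k) * N $$ (k, s))"
        using k s by (simp add: N'_def)
    qed simp
    also have "\<dots> = component (as ! s - bs ! t) (M $$ (t, s))"
      unfolding DN[symmetric] index_mult_mat_sum[OF gmaps_carrier[OF D] poly_mats_carrier[OF N] t s]
      by (simp add: component_sum)
    also have "\<dots> = M $$ (t, s)"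
      using M t s by (intro component_homog) (simp add: gmaps_def)
    finally show "(D * N') $$ (t, s) = M $$ (t, s)" .
  qed (use gmaps_carrier[OF D] gmaps_carrier[OF N'] gmaps_carrier[OF M] in auto)
  with N' show ?thesis by blast
qed

text \<open>The ring is counted as the zeroth free module, so that \<open>(E, D)\<close> is a resolution of the quotient
  by \<open>I\<close>. The augmentation then becomes one of the differentials, and inductions along
  the resolution start at the identity map of the ring.\<close>

definition resolves ::
  "'k::field mpoly set \<Rightarrow> (nat \<Rightarrow> 'g list) \<Rightarrow> (nat \<Rightarrow> 'k mpoly mat) \<Rightarrow> bool" where
  "resolves I E D \<longleftrightarrow> E 0 = [0] \<and> (\<forall>i. D i \<in> gmaps (E (Suc i)) (E i)) \<and>
     (\<lambda>f. (D 0 *\<^sub>v f) $ 0) ` poly_vecs n (length (E (Suc 0))) = I \<and>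
     (\<forall>i. (*\<^sub>v) (D (Suc i)) ` poly_vecs n (length (E (Suc (Suc i)))) =
          {f \<in> poly_vecs n (length (E (Suc i))). D i *\<^sub>v f = 0\<^sub>v (length (E i))})"

lemma resolves_gmaps: "resolves I E D \<Longrightarrow> D i \<in> gmaps (E (Suc i)) (E i)"
  by (simp add: resolves_def)

lemma resolves_exact:
  "resolves I E D \<Longrightarrow> f \<in> poly_vecs n (length (E (Suc i))) \<Longrightarrow> D i *\<^sub>v f = 0\<^sub>v (length (E i)) \<Longrightarrow>
    f \<in> (*\<^sub>v) (D (Suc i)) ` poly_vecs n (length (E (Suc (Suc i))))"
  by (simp add: resolves_def)

lemma resolves_comp:
  fixes D :: "nat \<Rightarrow> 'k::field mpoly mat"
  assumes "resolves I E D"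
  shows "D i * D (Suc i) = 0\<^sub>m (length (E i)) (length (E (Suc (Suc i))))"
proof (rule mat_col_eqI)
  note carr = resolves_gmaps[OF assms, THEN gmaps_carrier]
  fix s assume "s < dim_col (0\<^sub>m (length (E i)) (length (E (Suc (Suc i)))) :: 'k mpoly mat)"
  then have s: "s < length (E (Suc (Suc i)))" by simp
  have "D (Suc i) *\<^sub>v unit_vec (length (E (Suc (Suc i)))) s = col (D (Suc i)) s"
    using carr[of "Suc i"] s by (auto intro!: eq_vecI)
  moreover have "D (Suc i) *\<^sub>v unit_vec (length (E (Suc (Suc i)))) s \<in>
      {f \<in> poly_vecs n (length (E (Suc i))). D i *\<^sub>v f = 0\<^sub>v (length (E i))}"
    using assms unit_vec_in_poly_vecs unfolding resolves_def by blast
  ultimately show "col (D i * D (Suc i)) s = col (0\<^sub>m (length (E i)) (length (E (Suc (Suc i))))) s"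
    using s col_mult2[OF carr carr s] by simp
qed (use resolves_gmaps[OF assms, THEN gmaps_carrier] in auto)

lemma cycle_col_in_image:
  assumes "resolves I E D" "A \<in> poly_mats n (length (E (Suc i))) c"
    "D i * A = 0\<^sub>m (length (E i)) c" "s < c"
  shows "col A s \<in> (*\<^sub>v) (D (Suc i)) ` poly_vecs n (length (E (Suc (Suc i))))"
proof (rule resolves_exact[OF assms(1)])
  show "col A s \<in> poly_vecs n (length (E (Suc i)))"
    using assms by (intro poly_mats_col)
  show "D i *\<^sub>v col A s = 0\<^sub>v (length (E i))"
    using col_mult2[OF gmaps_carrier[OF resolves_gmaps[OF assms(1), of i]]
        poly_mats_carrier[OF assms(2)] assms(4)]
      assms(3,4) by simp
qed

lemma vec_in_image_augmentation:
  assumes "resolves I E D" "v \<in> carrier_vec 1" "v $ 0 \<in> I"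
  shows "v \<in> (*\<^sub>v) (D 0) ` poly_vecs n (length (E (Suc 0)))"
proof -
  obtain f where f: "f \<in> poly_vecs n (length (E (Suc 0)))" "v $ 0 = (D 0 *\<^sub>v f) $ 0"
    using assms by (auto simp: resolves_def)
  have "dim_row (D 0) = 1"
    using assms(1) gmaps_carrier[OF resolves_gmaps[OF assms(1), of 0]] by (simp add: resolves_def)
  then have "v = D 0 *\<^sub>v f"
    using f assms(2) by (intro eq_vecI) auto
  with f show ?thesis by blast
qed

text \<open>The comparison theorem: the source consists of free modules, so that its basis elements can be
  lifted one by one, and exactness of the target provides the preimages.\<close>

lemma comparison_map:
  assumes C: "\<And>i. C i \<in> gmaps (K (Suc i)) (K i)"
    and CC: "\<And>i. C i * C (Suc i) = 0\<^sub>m (length (K i)) (length (K (Suc (Suc i))))"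
    and D: "resolves I E D"
    and \<phi>0: "\<phi>0 \<in> gmaps (K 0) (E 0)"
    and \<phi>0_C: "\<And>s. s < length (K (Suc 0)) \<Longrightarrow> (\<phi>0 * C 0) $$ (0, s) \<in> I"
  shows "\<exists>\<phi>. \<phi> 0 = \<phi>0 \<and> (\<forall>i. \<phi> i \<in> gmaps (K i) (E i) \<and> D i * \<phi> (Suc i) = \<phi> i * C i)"
proof -
  define P where "P i \<psi> \<longleftrightarrow> \<psi> \<in> gmaps (K i) (E i) \<and> (i = 0 \<longrightarrow> \<psi> = \<phi>0) \<and>
    (\<forall>s<length (K (Suc i)). col (\<psi> * C i) s \<in> (*\<^sub>v) (D i) ` poly_vecs n (length (E (Suc i))))"
    for i \<psi>
  note Dg = resolves_gmaps[OF D]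
  have start: "\<exists>\<psi>. P 0 \<psi>"
  proof -
    have "col (\<phi>0 * C 0) s \<in> (*\<^sub>v) (D 0) ` poly_vecs n (length (E (Suc 0)))"
      if "s < length (K (Suc 0))" for s
    proof (rule vec_in_image_augmentation[OF D])
      have carr: "\<phi>0 * C 0 \<in> carrier_mat 1 (length (K (Suc 0)))"
        using gmaps_carrier[OF gmaps_mult[OF \<phi>0 C]] D by (simp add: resolves_def)
      then show "col (\<phi>0 * C 0) s \<in> carrier_vec 1"
        by (metis carrier_matD(1) col_dim)
      show "col (\<phi>0 * C 0) s $ 0 \<in> I"
        using carr that \<phi>0_C[OF that] by (subst index_col) (auto simp del: index_mult_mat)
    qed
    then show ?thesis using \<phi>0 by (auto simp: P_def)
  qed
  have step: "\<exists>\<psi>'. P (Suc i) \<psi>' \<and> D i * \<psi>' = \<psi> * C i" if P: "P i \<psi>" for i \<psi>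
  proof -
    have \<psi>: "\<psi> \<in> gmaps (K i) (E i)" using P by (simp add: P_def)
    have "col (\<psi> * C i) s \<in> (*\<^sub>v) (D i) ` poly_vecs n (length (E (Suc i)))"
      if "s < length (K (Suc i))" for s
      using P that by (simp add: P_def)
    then have "\<exists>N\<in>gmaps (K (Suc i)) (E (Suc i)). D i * N = \<psi> * C i"
      by (rule graded_lift_columns[OF Dg gmaps_mult[OF \<psi> C]])
    then obtain \<psi>' where \<psi>': "\<psi>' \<in> gmaps (K (Suc i)) (E (Suc i))" "D i * \<psi>' = \<psi> * C i"
      by blast
    \<comment> \<open>Composing the new map with the differential of the source gives cycles of the target, which
      exactness turns into boundaries, so the recursion can go on.\<close>
    have "D i * (\<psi>' * C (Suc i)) = (D i * \<psi>') * C (Suc i)"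
      by (rule assoc_mult_mat[OF gmaps_carrier[OF Dg] gmaps_carrier[OF \<psi>'(1)] gmaps_carrier[OF C],
            symmetric])
    also have "\<dots> = \<psi> * (C i * C (Suc i))"
      unfolding \<psi>'(2)
      by (rule assoc_mult_mat[OF gmaps_carrier[OF \<psi>] gmaps_carrier[OF C] gmaps_carrier[OF C]])
    also have "\<dots> = 0\<^sub>m (length (E i)) (length (K (Suc (Suc i))))"
      unfolding CC using gmaps_carrier[OF \<psi>] by simp
    finally have "P (Suc i) \<psi>'"
      using \<psi>'(1) cycle_col_in_image[OF D gmaps_poly_mats[OF gmaps_mult[OF \<psi>'(1) C]]]
      by (simp add: P_def)
    with \<psi>'(2) show ?thesis by blast
  qed
  obtain \<phi> where "\<And>i. P i (\<phi> i)" "\<And>i. D i * \<phi> (Suc i) = \<phi> i * C i"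
    using dependent_nat_choice[of P "\<lambda>i \<psi> \<psi>'. D i * \<psi>' = \<psi> * C i"] start step by metis
  then show ?thesis
    by (intro exI[of _ \<phi>]) (auto simp: P_def)
qed

end

section \<open>Degrees in a minimal resolution\<close>

context grading
begin

lemma augmentation_entry_in_ideal:
  assumes D: "resolves I E D" and s: "s < length (E (Suc 0))"
  shows "D 0 $$ (0, s) \<in> I"
proof -
  have carr: "D 0 \<in> carrier_mat 1 (length (E (Suc 0)))"
    using gmaps_carrier[OF resolves_gmaps[OF D, of 0]] D by (simp add: resolves_def)
  have "(D 0 *\<^sub>v unit_vec (length (E (Suc 0))) s) $ 0 = D 0 $$ (0, s)"
    using carr s by auto
  moreover have "(D 0 *\<^sub>v unit_vec (length (E (Suc 0))) s) $ 0 \<in> I"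
    using D unit_vec_in_poly_vecs unfolding resolves_def by blast
  ultimately show ?thesis by simp
qed

text \<open>Let \<open>A\<close> and \<open>B\<close> be comparison maps from a minimal resolution to another one and back. Their
  composite \<open>T = B A\<close> is homotopic to the identity, so \<open>1 - T\<close> is a sum of two matrices, each having a
  differential of the minimal resolution as a factor, and therefore has no constant terms. Every
  diagonal entry of \<open>T\<close> thus has constant term 1, which forces a nonzero constant term in the
  corresponding column of \<open>A\<close>; and a homogeneous entry has a nonzero constant term only between basis
  elements of equal degree.\<close>

lemma minimal_degrees_subset:
  fixes D D' :: "nat \<Rightarrow> 'k::field mpoly mat"
  assumes D: "resolves I E D" and minimal: "\<And>i. no_const_terms (D (Suc i))"
    and D': "resolves I E' D'"
  shows "set (E (Suc i)) \<subseteq> set (E' (Suc i))"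
proof -
  have E0: "E 0 = [0]" "E' 0 = [0]" using D D' by (auto simp: resolves_def)
  note Dg = resolves_gmaps[OF D] and Dg' = resolves_gmaps[OF D']
  note Dc = gmaps_carrier[OF Dg]
  have one: "(1\<^sub>m 1 :: 'k mpoly mat) \<in> gmaps [0] [0]"
    using gmaps_one[of "[0]"] by simp
  have one_D: "(1\<^sub>m 1 * X 0) $$ (0, s) \<in> I"
    if "resolves I Z X" "s < length (Z (Suc 0))" for X :: "nat \<Rightarrow> 'k mpoly mat" and Z s
    using gmaps_carrier[OF resolves_gmaps[OF that(1), of 0]] augmentation_entry_in_ideal[OF that] that(1)
    by (simp add: resolves_def)
  obtain A where A0: "A 0 = 1\<^sub>m 1" and A: "\<And>i. A i \<in> gmaps (E i) (E' i)"
    and A_comm: "\<And>i. D' i * A (Suc i) = A i * D i"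
    using comparison_map[of D E I E' D' "1\<^sub>m 1", OF Dg resolves_comp[OF D] D'] one one_D[OF D] E0 by auto
  obtain B where B0: "B 0 = 1\<^sub>m 1" and B: "\<And>i. B i \<in> gmaps (E' i) (E i)"
    and B_comm: "\<And>i. D i * B (Suc i) = B i * D' i"
    using comparison_map[of D' E' I E D "1\<^sub>m 1", OF Dg' resolves_comp[OF D'] D] one one_D[OF D'] E0 by auto
  note Ac = gmaps_carrier[OF A] and Bc = gmaps_carrier[OF B]
  define T where "T i = B i * A i" for i
  have T: "T i \<in> gmaps (E i) (E i)" for i
    unfolding T_def by (rule gmaps_mult[OF B A])
  note Tc = gmaps_carrier[OF T]
  have T0: "T 0 = 1\<^sub>m (length (E 0))"
    by (simp add: T_def A0 B0 E0)
  have T_comm: "D i * T (Suc i) = T i * D i" for i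
  proof -
    have "D i * T (Suc i) = (B i * D' i) * A (Suc i)"
      unfolding T_def B_comm[symmetric] by (rule assoc_mult_mat[OF Dc Bc Ac, symmetric])
    also have "\<dots> = B i * (A i * D i)"
      unfolding A_comm[symmetric] by (rule assoc_mult_mat[OF Bc gmaps_carrier[OF Dg'] Ac])
    also have "\<dots> = T i * D i"
      unfolding T_def by (rule assoc_mult_mat[OF Bc Ac Dc, symmetric])
    finally show ?thesis .
  qed
  \<comment> \<open>The equation says that the columns of \<open>1 - T (Suc i) - h * D i\<close> are cycles, so that the next
    piece of the homotopy can be found as a lift of this matrix. At 0 the homotopy is zero,
    because \<open>T 0\<close> is the identity.\<close>
  define homotopy_at where "homotopy_at i h \<longleftrightarrow> h \<in> poly_mats n (length (E (Suc i))) (length (E i)) \<and>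
    no_const_terms (h * D i) \<and> (1\<^sub>m (length (E i)) - T i - D i * h) * D i =
      0\<^sub>m (length (E i)) (length (E (Suc i)))" for i h
  have step: "\<exists>h'. homotopy_at (Suc i) h' \<and> D (Suc i) * h' = 1\<^sub>m (length (E (Suc i))) - T (Suc i) - h * D i"
    if h: "homotopy_at i h" for i h
  proof -
    have hp: "h \<in> poly_mats n (length (E (Suc i))) (length (E i))"
      using h by (simp add: homotopy_at_def)
    note hc = poly_mats_carrier[OF hp]
    let ?M = "1\<^sub>m (length (E (Suc i))) - T (Suc i) - h * D i"
    have Mp: "?M \<in> poly_mats n (length (E (Suc i))) (length (E (Suc i)))"
      by (intro poly_mats_minus poly_mats_one gmaps_poly_mats[OF T]
          poly_mats_mult[OF hp gmaps_poly_mats[OF Dg]])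
    have "D i * ?M = D i * (1\<^sub>m (length (E (Suc i))) - T (Suc i)) - D i * (h * D i)"
      by (rule mult_minus_distrib_mat[OF Dc minus_carrier_mat[OF Tc] mult_carrier_mat[OF hc Dc]])
    also have "D i * (1\<^sub>m (length (E (Suc i))) - T (Suc i)) = D i * 1\<^sub>m (length (E (Suc i))) - T i * D i"
      unfolding T_comm[symmetric] by (rule mult_minus_distrib_mat[OF Dc _ Tc]) simp
    also have "D i * (h * D i) = D i * h * D i"
      by (rule assoc_mult_mat[OF Dc hc Dc, symmetric])
    also have "D i * 1\<^sub>m (length (E (Suc i))) = 1\<^sub>m (length (E i)) * D i"
      using Dc[of i] by simp
    also have "1\<^sub>m (length (E i)) * D i - T i * D i = (1\<^sub>m (length (E i)) - T i) * D i"
      by (rule minus_mult_distrib_mat[OF _ Tc Dc, symmetric]) simp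
    also have "\<dots> - D i * h * D i = (1\<^sub>m (length (E i)) - T i - D i * h) * D i"
      by (rule minus_mult_distrib_mat[OF minus_carrier_mat[OF Tc] mult_carrier_mat[OF Dc hc] Dc, symmetric])
    also have "\<dots> = 0\<^sub>m (length (E i)) (length (E (Suc i)))"
      using h by (simp add: homotopy_at_def)
    finally have "D i * ?M = 0\<^sub>m (length (E i)) (length (E (Suc i)))" .
    from cycle_col_in_image[OF D Mp this]
    obtain h' where h': "h' \<in> poly_mats n (length (E (Suc (Suc i)))) (length (E (Suc i)))"
      and Dh': "D (Suc i) * h' = ?M"
      using lift_columns[OF gmaps_poly_mats[OF Dg] poly_mats_carrier[OF Mp]] by blast
    have "1\<^sub>m (length (E (Suc i))) - T (Suc i) - ?M = h * D i"
      using Tc[of "Suc i"] hc Dc[of i] by (intro eq_matI) auto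
    moreover have "h * D i * D (Suc i) = 0\<^sub>m (length (E (Suc i))) (length (E (Suc (Suc i))))"
      unfolding assoc_mult_mat[OF hc Dc Dc] resolves_comp[OF D] using hc by simp
    moreover have "no_const_terms (h' * D (Suc i))"
      by (rule no_const_terms_mult_right[OF minimal poly_mats_carrier[OF h'] Dc])
    ultimately have "homotopy_at (Suc i) h'"
      using h' by (simp add: homotopy_at_def Dh')
    with Dh' show ?thesis by blast
  qed
  have "\<exists>h. homotopy_at i h"
  proof (induction i)
    case 0
    have "1\<^sub>m (length (E 0)) - T 0 - D 0 * 0\<^sub>m (length (E (Suc 0))) (length (E 0)) =
        0\<^sub>m (length (E 0)) (length (E 0))"
      using Dc[of 0] by (intro eq_matI) (auto simp: T0)
    then have "homotopy_at 0 (0\<^sub>m (length (E (Suc 0))) (length (E 0)))"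
      using Dc[of 0] by (simp add: homotopy_at_def poly_mats_zero no_const_terms_def)
    then show ?case by blast
  next
    case (Suc i)
    then show ?case using step by blast
  qed
  then obtain h where h: "homotopy_at i h" by blast
  with step obtain h' where h': "homotopy_at (Suc i) h'"
    and Dh': "D (Suc i) * h' = 1\<^sub>m (length (E (Suc i))) - T (Suc i) - h * D i" by blast
  show ?thesis
  proof
    fix a assume "a \<in> set (E (Suc i))"
    then obtain s where s: "s < length (E (Suc i))" "a = E (Suc i) ! s"
      by (auto simp: in_set_conv_nth)
    have hc: "h \<in> carrier_mat (length (E (Suc i))) (length (E i))"
      and h'c: "h' \<in> carrier_mat (length (E (Suc (Suc i)))) (length (E (Suc i)))"
      using h h' by (auto simp: homotopy_at_def poly_mats_def)
    have "no_const_terms (D (Suc i) * h')"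
      by (rule no_const_terms_mult_left[OF minimal Dc h'c])
    then have "Poly_Mapping.lookup ((D (Suc i) * h') $$ (s, s)) 0 = 0"
      using s Dc[of "Suc i"] h'c by (auto simp: no_const_terms_def simp del: index_mult_mat(1))
    moreover have "Poly_Mapping.lookup ((h * D i) $$ (s, s)) 0 = 0"
      using h s Dc[of i] hc by (auto simp: homotopy_at_def no_const_terms_def simp del: index_mult_mat(1))
    ultimately have "Poly_Mapping.lookup (T (Suc i) $$ (s, s)) 0 = 1"
      unfolding Dh' using s Tc[of "Suc i"] hc Dc[of i]
      by (simp add: lookup_minus lookup_one del: index_mult_mat(1))
    moreover have "T (Suc i) $$ (s, s) =
        (\<Sum>t<length (E' (Suc i)). B (Suc i) $$ (s, t) * A (Suc i) $$ (t, s))"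
      unfolding T_def by (rule index_mult_mat_sum[OF Bc Ac s(1) s(1)])
    ultimately have "(\<Sum>t<length (E' (Suc i)). Poly_Mapping.lookup (B (Suc i) $$ (s, t)) 0 *
        Poly_Mapping.lookup (A (Suc i) $$ (t, s)) 0) \<noteq> 0"
      by (simp add: lookup_sum const_term_mult)
    then obtain t where t: "t < length (E' (Suc i))"
      "Poly_Mapping.lookup (A (Suc i) $$ (t, s)) 0 \<noteq> 0"
      by (metis (no_types, lifting) lessThan_iff mult_zero_right sum.not_neutral_contains_not_neutral)
    then show "a \<in> set (E' (Suc i))"
      using gmaps_const_term[OF A t(1) s(1) t(2)] s(2) by simp
  qed
qed

end

section \<open>Mapping cones\<close>

lemma poly_vecs_append:
  assumes "x \<in> poly_vecs n a" "y \<in> poly_vecs n b"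
  shows "x @\<^sub>v y \<in> poly_vecs n (a + b)"
  using assms by (auto simp: poly_vecs_def append_vec_def Let_def)

lemma poly_vecs_append_cases:
  assumes "f \<in> poly_vecs n (a + b)"
  obtains x y where "f = x @\<^sub>v y" "x \<in> poly_vecs n a" "y \<in> poly_vecs n b"
proof
  show "f = vec_first f a @\<^sub>v vec_last f b"
    using assms by (simp add: poly_vecs_def)
  show "vec_first f a \<in> poly_vecs n a" "vec_last f b \<in> poly_vecs n b"
    using assms by (auto simp: poly_vecs_def vec_first_def vec_last_def)
qed

lemma poly_vecs_add: "f \<in> poly_vecs n m \<Longrightarrow> g \<in> poly_vecs n m \<Longrightarrow> f + g \<in> poly_vecs n m"
  by (auto simp: poly_vecs_def poly_ring_add)

lemma poly_vecs_uminus: "f \<in> poly_vecs n m \<Longrightarrow> - f \<in> poly_vecs n m"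
  by (auto simp: poly_vecs_def poly_ring_uminus)

lemma mult_mat_vec_uminus:
  fixes A :: "'a::comm_ring_1 mat"
  assumes "A \<in> carrier_mat r m" "f \<in> carrier_vec m"
  shows "A *\<^sub>v (- f) = - (A *\<^sub>v f)"
  using assms by (auto intro!: eq_vecI)

context grading
begin

text \<open>In position \<open>i + 1\<close> the mapping cone is the sum of the module with degrees \<open>E (i + 1)\<close> and the
  shift by \<open>\<delta>\<close> of the module with degrees \<open>K i\<close>.\<close>

definition cone_degrees :: "(nat \<Rightarrow> 'g list) \<Rightarrow> 'g \<Rightarrow> (nat \<Rightarrow> 'g list) \<Rightarrow> nat \<Rightarrow> 'g list" where
  "cone_degrees E \<delta> K i = E i @ (case i of 0 \<Rightarrow> [] | Suc i' \<Rightarrow> map ((+) \<delta>) (K i'))"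

lemma gmaps_shift: "A \<in> gmaps as bs \<Longrightarrow> A \<in> gmaps (map ((+) \<delta>) as) (map ((+) \<delta>) bs)"
  by (auto simp: gmaps_def)

lemma gmaps_uminus: "A \<in> gmaps as bs \<Longrightarrow> - A \<in> gmaps as bs"
  by (auto simp: gmaps_def poly_mats_def poly_ring_uminus homog_uminus)

lemma gmaps_four_block:
  assumes "A \<in> gmaps as cs" "B \<in> gmaps bs cs" "C \<in> gmaps as ds" "D \<in> gmaps bs ds"
  shows "four_block_mat A B C D \<in> gmaps (as @ bs) (cs @ ds)"
  using assms by (auto simp: gmaps_def poly_mats_def nth_append)

lemma no_const_terms_four_block:
  assumes "A \<in> carrier_mat a c" "B \<in> carrier_mat a d" "C \<in> carrier_mat b c" "D \<in> carrier_mat b d"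
    "no_const_terms A" "no_const_terms B" "no_const_terms C" "no_const_terms D"
  shows "no_const_terms (four_block_mat A B C D)"
  using assms by (auto simp: no_const_terms_def)

text \<open>Multiplication by \<open>m\<close> induces an injection of the quotient by \<open>Q = J : m\<close>, shifted by the
  degree of \<open>m\<close>, into the quotient by \<open>J\<close>, and its cokernel is the quotient by \<open>J + (m)\<close>. Hence the mapping
  cone of a lift \<open>\<phi>\<close> of this injection to the resolutions is a resolution of the cokernel. It is
  minimal as soon as \<open>\<phi>\<close> has no constant terms, and this is automatic when \<open>\<phi>\<close> never joins basis
  elements of the same degree.\<close>

lemma mapping_cone:
  fixes D C :: "nat \<Rightarrow> 'k::field mpoly mat"
  assumes D: "resolves J E D" and D_min: "\<And>i. no_const_terms (D i)"
    and C: "resolves Q K C" and C_min: "\<And>i. no_const_terms (C i)"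
    and m: "homog \<delta> m" "m \<in> poly_ring n"
    and colon: "\<And>y. y \<in> poly_ring n \<Longrightarrow> m * y \<in> J \<longleftrightarrow> y \<in> Q"
    and disjoint: "\<And>i. set (E i) \<inter> (+) \<delta> ` set (K i) = {}"
  shows "\<exists>\<Delta>. resolves {a + m * b |a b. a \<in> J \<and> b \<in> poly_ring n} (cone_degrees E \<delta> K) \<Delta> \<and>
    (\<forall>i. no_const_terms (\<Delta> i))"
proof -
  have E0: "E 0 = [0]" and K0: "K 0 = [0]" using D C by (auto simp: resolves_def)
  define K' where "K' i = map ((+) \<delta>) (K i)" for i
  have len: "length (K' i) = length (K i)" for i by (simp add: K'_def)
  note Dg = resolves_gmaps[OF D] and Cg0 = resolves_gmaps[OF C]
  have Cg: "C i \<in> gmaps (K' (Suc i)) (K' i)" for i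
    unfolding K'_def by (rule gmaps_shift[OF Cg0])
  have CC: "C i * C (Suc i) = 0\<^sub>m (length (K' i)) (length (K' (Suc (Suc i))))" for i
    unfolding len by (rule resolves_comp[OF C])
  define \<mu> where "\<mu> = mat 1 1 (\<lambda>_. m)"
  have \<mu>: "\<mu> \<in> gmaps (K' 0) (E 0)"
    using m by (auto simp: \<mu>_def gmaps_def poly_mats_def K'_def K0 E0)
  have "(\<mu> * C 0) $$ (0, s) \<in> J" if "s < length (K' (Suc 0))" for s
  proof -
    have s: "s < length (K (Suc 0))" using that by (simp add: len)
    have c: "C 0 \<in> carrier_mat 1 (length (K (Suc 0)))" and p: "C 0 $$ (0, s) \<in> poly_ring n"
      using Cg0[of 0] s by (auto simp: gmaps_def poly_mats_def K0)
    have "(\<mu> * C 0) $$ (0, s) = (\<Sum>k<1. \<mu> $$ (0, k) * C 0 $$ (k, s))"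
      by (rule index_mult_mat_sum[OF _ c _ s]) (auto simp: \<mu>_def)
    then show ?thesis
      using colon[OF p] augmentation_entry_in_ideal[OF C s] by (simp add: \<mu>_def)
  qed
  from comparison_map[of C K' J E D \<mu>, OF Cg CC D \<mu> this]
  obtain \<phi> where \<phi>0: "\<phi> 0 = \<mu>" and \<phi>: "\<And>i. \<phi> i \<in> gmaps (K' i) (E i)"
    and \<phi>_comm: "\<And>i. D i * \<phi> (Suc i) = \<phi> i * C i" by auto
  have \<phi>_min: "no_const_terms (\<phi> i)" for i
    unfolding no_const_terms_def
  proof (intro allI impI, rule ccontr)
    fix t s assume ts: "t < dim_row (\<phi> i)" "s < dim_col (\<phi> i)"
      and nz: "Poly_Mapping.lookup (\<phi> i $$ (t, s)) 0 \<noteq> 0"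
    have t: "t < length (E i)" and s: "s < length (K' i)"
      using ts gmaps_carrier[OF \<phi>[of i]] by auto
    have "K' i ! s = E i ! t"
      by (rule gmaps_const_term[OF \<phi> t s nz])
    moreover have "K' i ! s \<in> (+) \<delta> ` set (K i)" using s by (simp add: K'_def)
    ultimately show False using disjoint[of i] t by (metis disjoint_iff nth_mem)
  qed
  \<comment> \<open>The shifted complex enters the cone one step later, so it is preceded by a zero module.\<close>
  define K'' where "K'' i = (case i of 0 \<Rightarrow> [] | Suc i' \<Rightarrow> K' i')" for i
  define C'' where "C'' i = (case i of 0 \<Rightarrow> 0\<^sub>m 0 (length (K' 0)) | Suc i' \<Rightarrow> C i')" for i
  have K''_Suc: "K'' (Suc i) = K' i" for i by (simp add: K''_def)
  have N: "cone_degrees E \<delta> K i = E i @ K'' i" for i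
    by (auto simp: cone_degrees_def K''_def K'_def split: nat.split)
  have C''g: "C'' i \<in> gmaps (K' i) (K'' i)" for i
    using gmaps_zero[of "[]" "K' 0"] Cg by (auto simp: C''_def K''_def split: nat.split)
  have C''_min: "no_const_terms (- C'' i)" for i
    using C_min by (auto simp: C''_def no_const_terms_def split: nat.split)
  have C''_C: "C'' i *\<^sub>v (C i *\<^sub>v z) = 0\<^sub>v (length (K'' i))" if "z \<in> poly_vecs n (length (K' (Suc i)))" for i z
  proof (cases i)
    case (Suc i')
    have "C i' *\<^sub>v (C i *\<^sub>v z) = (C i' * C i) *\<^sub>v z"
      unfolding Suc
      by (rule assoc_mult_mat_vec[OF gmaps_carrier[OF Cg] gmaps_carrier[OF Cg]
            poly_vecs_carrier[OF that[unfolded Suc]], symmetric])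
    also have "\<dots> = 0\<^sub>v (length (K' i'))"
      unfolding Suc CC using poly_vecs_carrier[OF that] Suc by auto
    finally show ?thesis by (simp add: C''_def K''_def Suc)
  qed (auto simp: C''_def K''_def)
  define \<Delta> where "\<Delta> i = four_block_mat (D i) (\<phi> i) (0\<^sub>m (length (K'' i)) (length (E (Suc i)))) (- C'' i)" for i
  have \<Delta>: "\<Delta> i \<in> gmaps (cone_degrees E \<delta> K (Suc i)) (cone_degrees E \<delta> K i)" for i
    unfolding \<Delta>_def N K''_Suc
    by (intro gmaps_four_block Dg \<phi> gmaps_zero gmaps_uminus C''g)
  have \<Delta>_min: "no_const_terms (\<Delta> i)" for i
    unfolding \<Delta>_def
    by (rule no_const_terms_four_block[OF gmaps_carrier[OF Dg] gmaps_carrier[OF \<phi>] _ _ D_min \<phi>_min _ C''_min])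
      (use gmaps_carrier[OF C''g[of i]] in \<open>auto simp: no_const_terms_def\<close>)
  have \<Delta>_mult: "\<Delta> i *\<^sub>v (x @\<^sub>v y) = (D i *\<^sub>v x + \<phi> i *\<^sub>v y) @\<^sub>v (- (C'' i *\<^sub>v y))"
    if x: "x \<in> poly_vecs n (length (E (Suc i)))" and y: "y \<in> poly_vecs n (length (K' i))" for i x y
  proof -
    have "\<Delta> i *\<^sub>v (x @\<^sub>v y) = (D i *\<^sub>v x + \<phi> i *\<^sub>v y) @\<^sub>v
        (0\<^sub>m (length (K'' i)) (length (E (Suc i))) *\<^sub>v x + (- C'' i) *\<^sub>v y)"
      unfolding \<Delta>_def
      by (rule four_block_mat_mult_vec[OF gmaps_carrier[OF Dg] gmaps_carrier[OF \<phi>] _ _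
            poly_vecs_carrier[OF x] poly_vecs_carrier[OF y]])
        (use gmaps_carrier[OF C''g[of i]] in auto)
    moreover have "0\<^sub>m (length (K'' i)) (length (E (Suc i))) *\<^sub>v x + (- C'' i) *\<^sub>v y = - (C'' i *\<^sub>v y)"
      using gmaps_carrier[OF C''g[of i]] poly_vecs_carrier[OF x] poly_vecs_carrier[OF y] by auto
    ultimately show ?thesis by simp
  qed
  have Dx: "D i *\<^sub>v x \<in> poly_vecs n (length (E i))" if "x \<in> poly_vecs n (length (E (Suc i)))" for i x
    by (rule poly_mats_mult_vec[OF gmaps_poly_mats[OF Dg] that])
  have \<phi>y: "\<phi> i *\<^sub>v y \<in> poly_vecs n (length (E i))" if "y \<in> poly_vecs n (length (K' i))" for i y
    by (rule poly_mats_mult_vec[OF gmaps_poly_mats[OF \<phi>] that])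
  have Cz: "C i *\<^sub>v z \<in> poly_vecs n (length (K' i))" if "z \<in> poly_vecs n (length (K' (Suc i)))" for i z
    by (rule poly_mats_mult_vec[OF gmaps_poly_mats[OF Cg] that])
  have \<phi>0_mult: "(\<phi> 0 *\<^sub>v y) $ 0 = m * y $ 0" if "y \<in> poly_vecs n (length (K' 0))" for y
  proof -
    have "(\<phi> 0 *\<^sub>v y) $ 0 = (\<Sum>k<1. \<phi> 0 $$ (0, k) * y $ k)"
      by (rule index_mult_vec_sum[where r = 1])
        (use that in \<open>auto simp: \<phi>0 \<mu>_def poly_vecs_def K'_def K0\<close>)
    then show ?thesis by (simp add: \<phi>0 \<mu>_def)
  qed
  have D_\<phi>: "D i *\<^sub>v (\<phi> (Suc i) *\<^sub>v z) = \<phi> i *\<^sub>v (C i *\<^sub>v z)"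
    if z: "z \<in> poly_vecs n (length (K' (Suc i)))" for i z
  proof -
    have "D i *\<^sub>v (\<phi> (Suc i) *\<^sub>v z) = (D i * \<phi> (Suc i)) *\<^sub>v z"
      by (rule assoc_mult_mat_vec[OF gmaps_carrier[OF Dg] gmaps_carrier[OF \<phi>] poly_vecs_carrier[OF z], symmetric])
    also have "\<dots> = \<phi> i *\<^sub>v (C i *\<^sub>v z)"
      unfolding \<phi>_comm
      by (rule assoc_mult_mat_vec[OF gmaps_carrier[OF \<phi>] gmaps_carrier[OF Cg] poly_vecs_carrier[OF z]])
    finally show ?thesis .
  qed
  have DD: "D i *\<^sub>v (D (Suc i) *\<^sub>v x) = 0\<^sub>v (length (E i))"
    if x: "x \<in> poly_vecs n (length (E (Suc (Suc i))))" for i x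
    using x D unfolding resolves_def by blast
  have D_add: "D i *\<^sub>v (x + x') = D i *\<^sub>v x + D i *\<^sub>v x'"
    if "x \<in> poly_vecs n (length (E (Suc i)))" "x' \<in> poly_vecs n (length (E (Suc i)))" for i x x'
    by (rule mult_add_distrib_mat_vec[OF gmaps_carrier[OF Dg] poly_vecs_carrier[OF that(1)] poly_vecs_carrier[OF that(2)]])
  have J_image: "(\<lambda>f. (D 0 *\<^sub>v f) $ 0) ` poly_vecs n (length (E (Suc 0))) = J"
    using D by (simp only: resolves_def)
  have J: "a \<in> J \<longleftrightarrow> (\<exists>x\<in>poly_vecs n (length (E (Suc 0))). a = (D 0 *\<^sub>v x) $ 0)" for a
    unfolding J_image[symmetric] by (rule image_iff)
  have J_uminus: "- a \<in> J" if aJ: "a \<in> J" for a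
  proof -
    obtain x where x: "x \<in> poly_vecs n (length (E (Suc 0)))" "a = (D 0 *\<^sub>v x) $ 0"
      using aJ unfolding J by blast
    have "(D 0 *\<^sub>v (- x)) $ 0 = - a"
      using mult_mat_vec_uminus[OF gmaps_carrier[OF Dg] poly_vecs_carrier[OF x(1)]] x(2)
        gmaps_carrier[OF Dg[of 0]] E0 by simp
    then show ?thesis unfolding J using poly_vecs_uminus[OF x(1)] by (metis (no_types))
  qed
  have image: "(\<lambda>f. (\<Delta> 0 *\<^sub>v f) $ 0) ` poly_vecs n (length (cone_degrees E \<delta> K (Suc 0))) =
      {a + m * b |a b. a \<in> J \<and> b \<in> poly_ring n}" (is "?L = ?R")
  proof -
    have val: "(\<Delta> 0 *\<^sub>v (x @\<^sub>v y)) $ 0 = (D 0 *\<^sub>v x) $ 0 + m * y $ 0"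
      if "x \<in> poly_vecs n (length (E (Suc 0)))" "y \<in> poly_vecs n (length (K' 0))" for x y
      unfolding \<Delta>_mult[OF that] \<phi>0_mult[OF that(2), symmetric]
      using gmaps_carrier[OF Dg[of 0]] gmaps_carrier[OF \<phi>[of 0]]
      by (simp add: E0 append_vec_def Let_def)
    show ?thesis
    proof (intro equalityI subsetI)
      fix p assume "p \<in> ?L"
      then obtain f where f: "f \<in> poly_vecs n (length (E (Suc 0)) + length (K' 0))" "p = (\<Delta> 0 *\<^sub>v f) $ 0"
        by (auto simp: N K''_Suc)
      obtain x y where "f = x @\<^sub>v y" and x: "x \<in> poly_vecs n (length (E (Suc 0)))"
        and y: "y \<in> poly_vecs n (length (K' 0))"
        using f(1) by (rule poly_vecs_append_cases)
      with f(2) val[OF x y] have "p = (D 0 *\<^sub>v x) $ 0 + m * y $ 0" by simp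
      moreover have "(D 0 *\<^sub>v x) $ 0 \<in> J" unfolding J using x by blast
      moreover have "y $ 0 \<in> poly_ring n" using y by (simp add: poly_vecs_def len K0)
      ultimately show "p \<in> ?R" by blast
    next
      fix p assume "p \<in> ?R"
      then obtain a b where p: "p = a + m * b" and "a \<in> J" and b: "b \<in> poly_ring n" by blast
      then obtain x where x: "x \<in> poly_vecs n (length (E (Suc 0)))" "a = (D 0 *\<^sub>v x) $ 0"
        unfolding J by blast
      have y: "vec 1 (\<lambda>_. b) \<in> poly_vecs n (length (K' 0))"
        using b by (simp add: poly_vecs_def len K0)
      have "p = (\<Delta> 0 *\<^sub>v (x @\<^sub>v vec 1 (\<lambda>_. b))) $ 0"
        unfolding val[OF x(1) y] p x(2) by simp
      moreover have "x @\<^sub>v vec 1 (\<lambda>_. b) \<in> poly_vecs n (length (cone_degrees E \<delta> K (Suc 0)))"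
        using poly_vecs_append[OF x(1) y] by (simp add: N K''_Suc)
      ultimately show "p \<in> ?L" by blast
    qed
  qed
  have exact: "(*\<^sub>v) (\<Delta> (Suc i)) ` poly_vecs n (length (cone_degrees E \<delta> K (Suc (Suc i)))) =
      {f \<in> poly_vecs n (length (cone_degrees E \<delta> K (Suc i))). \<Delta> i *\<^sub>v f = 0\<^sub>v (length (cone_degrees E \<delta> K i))}"
    (is "?L = ?R") for i
  proof (intro equalityI subsetI)
    fix f assume "f \<in> ?L"
    then obtain g where g: "g \<in> poly_vecs n (length (E (Suc (Suc i))) + length (K' (Suc i)))" "f = \<Delta> (Suc i) *\<^sub>v g"
      by (auto simp: N K''_Suc)
    obtain x y where gxy: "g = x @\<^sub>v y" and x: "x \<in> poly_vecs n (length (E (Suc (Suc i))))"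
      and y: "y \<in> poly_vecs n (length (K' (Suc i)))"
      using g(1) by (rule poly_vecs_append_cases)
    have f: "f = (D (Suc i) *\<^sub>v x + \<phi> (Suc i) *\<^sub>v y) @\<^sub>v - (C i *\<^sub>v y)"
      unfolding g(2) gxy \<Delta>_mult[OF x y] by (simp add: C''_def)
    have first: "D (Suc i) *\<^sub>v x + \<phi> (Suc i) *\<^sub>v y \<in> poly_vecs n (length (E (Suc i)))"
      by (rule poly_vecs_add[OF Dx[OF x] \<phi>y[OF y]])
    have second: "- (C i *\<^sub>v y) \<in> poly_vecs n (length (K' i))"
      by (rule poly_vecs_uminus[OF Cz[OF y]])
    have "D i *\<^sub>v (D (Suc i) *\<^sub>v x + \<phi> (Suc i) *\<^sub>v y) + \<phi> i *\<^sub>v - (C i *\<^sub>v y) =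
        0\<^sub>v (length (E i)) + \<phi> i *\<^sub>v (C i *\<^sub>v y) + - (\<phi> i *\<^sub>v (C i *\<^sub>v y))"
      unfolding D_add[OF Dx[OF x] \<phi>y[OF y]] DD[OF x] D_\<phi>[OF y]
        mult_mat_vec_uminus[OF gmaps_carrier[OF \<phi>] poly_vecs_carrier[OF Cz[OF y]]] ..
    also have "\<dots> = 0\<^sub>v (length (E i))"
      using poly_vecs_carrier[OF \<phi>y[OF Cz[OF y]]] by auto
    finally have 1: "D i *\<^sub>v (D (Suc i) *\<^sub>v x + \<phi> (Suc i) *\<^sub>v y) + \<phi> i *\<^sub>v - (C i *\<^sub>v y) =
        0\<^sub>v (length (E i))" .
    have 2: "C'' i *\<^sub>v - (C i *\<^sub>v y) = 0\<^sub>v (length (K'' i))"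
      unfolding mult_mat_vec_uminus[OF gmaps_carrier[OF C''g] poly_vecs_carrier[OF Cz[OF y]]] C''_C[OF y]
      by simp
    have "\<Delta> i *\<^sub>v f = 0\<^sub>v (length (cone_degrees E \<delta> K i))"
      unfolding f \<Delta>_mult[OF first second] 1 2 N by auto
    moreover have "f \<in> poly_vecs n (length (cone_degrees E \<delta> K (Suc i)))"
      unfolding f using poly_vecs_append[OF first second] by (simp add: N K''_Suc)
    ultimately show "f \<in> ?R" by blast
  next
    fix f assume "f \<in> ?R"
    then have f: "f \<in> poly_vecs n (length (E (Suc i)) + length (K' i))"
      and \<Delta>f: "\<Delta> i *\<^sub>v f = 0\<^sub>v (length (E i) + length (K'' i))"
      by (auto simp: N K''_Suc)
    obtain x y where fxy: "f = x @\<^sub>v y" and x: "x \<in> poly_vecs n (length (E (Suc i)))"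
      and y: "y \<in> poly_vecs n (length (K' i))"
      using f by (rule poly_vecs_append_cases)
    have "(D i *\<^sub>v x + \<phi> i *\<^sub>v y) @\<^sub>v (- (C'' i *\<^sub>v y)) = 0\<^sub>v (length (E i)) @\<^sub>v 0\<^sub>v (length (K'' i))"
      using \<Delta>f unfolding fxy \<Delta>_mult[OF x y] by auto
    then have xy: "D i *\<^sub>v x + \<phi> i *\<^sub>v y = 0\<^sub>v (length (E i))" "- (C'' i *\<^sub>v y) = 0\<^sub>v (length (K'' i))"
      using append_vec_eq[of "D i *\<^sub>v x + \<phi> i *\<^sub>v y" "length (E i)" "0\<^sub>v (length (E i))"]
        poly_vecs_carrier[OF poly_vecs_add[OF Dx[OF x] \<phi>y[OF y]]] by auto
    \<comment> \<open>For \<open>i = 0\<close> this is the colon condition: \<open>m * y $ 0\<close> lies in \<open>J\<close>. Otherwise it is the exactness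
      of the shifted complex.\<close>
    have "\<exists>z\<in>poly_vecs n (length (K' (Suc i))). y = C i *\<^sub>v z"
    proof (cases i)
      case 0
      have y': "y \<in> poly_vecs n (length (K' 0))" and x': "x \<in> poly_vecs n (length (E (Suc 0)))"
        using x y 0 by auto
      have "(D 0 *\<^sub>v x + \<phi> 0 *\<^sub>v y) $ 0 = 0"
        using xy(1) 0 by (simp add: E0)
      then have "(D 0 *\<^sub>v x) $ 0 + m * y $ 0 = 0"
        using \<phi>0_mult[OF y'] gmaps_carrier[OF \<phi>[of 0]] E0 by simp
      then have "m * y $ 0 = - ((D 0 *\<^sub>v x) $ 0)"
        by (simp add: add_eq_0_iff)
      moreover have "(D 0 *\<^sub>v x) $ 0 \<in> J" unfolding J using x' by blast
      ultimately have my: "m * y $ 0 \<in> J" using J_uminus by metis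
      have y0: "y $ 0 \<in> poly_ring n" "y \<in> carrier_vec 1"
        using y' by (auto simp: poly_vecs_def len K0)
      have "y $ 0 \<in> Q" using my colon[OF y0(1)] by blast
      from vec_in_image_augmentation[OF C y0(2) this] show ?thesis
        unfolding 0 len by blast
    next
      case (Suc i')
      have "C i' *\<^sub>v y \<in> carrier_vec (length (K i'))"
        by (rule mult_mat_vec_carrier[OF gmaps_carrier[OF Cg0]])
          (use poly_vecs_carrier[OF y] in \<open>simp add: len Suc\<close>)
      then have "C i' *\<^sub>v y = 0\<^sub>v (length (K i'))"
        using xy(2) by (simp add: C''_def K''_def Suc len uminus_zero_vec_eq)
      then show ?thesis
        using resolves_exact[OF C, of y i'] y unfolding Suc len by blast
    qed
    then obtain z where z: "z \<in> poly_vecs n (length (K' (Suc i)))" and yz: "y = C i *\<^sub>v z" by blast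
    \<comment> \<open>Correcting \<open>x\<close> by \<open>\<phi> z\<close> makes it a cycle of the target complex.\<close>
    let ?w = "x + \<phi> (Suc i) *\<^sub>v z"
    have w: "?w \<in> poly_vecs n (length (E (Suc i)))"
      by (rule poly_vecs_add[OF x \<phi>y[OF z]])
    have "D i *\<^sub>v ?w = 0\<^sub>v (length (E i))"
      unfolding D_add[OF x \<phi>y[OF z]] D_\<phi>[OF z] yz[symmetric] by (rule xy(1))
    then obtain t where t: "t \<in> poly_vecs n (length (E (Suc (Suc i))))" and wt: "?w = D (Suc i) *\<^sub>v t"
      using resolves_exact[OF D w] by blast
    have z': "- z \<in> poly_vecs n (length (K' (Suc i)))" by (rule poly_vecs_uminus[OF z])
    have "\<Delta> (Suc i) *\<^sub>v (t @\<^sub>v - z) = (D (Suc i) *\<^sub>v t + \<phi> (Suc i) *\<^sub>v (- z)) @\<^sub>v - (C i *\<^sub>v (- z))"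
      unfolding \<Delta>_mult[OF t z'] by (simp add: C''_def)
    also have "D (Suc i) *\<^sub>v t + \<phi> (Suc i) *\<^sub>v (- z) = x"
      unfolding wt[symmetric] mult_mat_vec_uminus[OF gmaps_carrier[OF \<phi>] poly_vecs_carrier[OF z]]
      using poly_vecs_carrier[OF \<phi>y[OF z]] poly_vecs_carrier[OF x] by (intro eq_vecI) auto
    also have "- (C i *\<^sub>v (- z)) = y"
      unfolding mult_mat_vec_uminus[OF gmaps_carrier[OF Cg] poly_vecs_carrier[OF z]] yz by simp
    finally have "f = \<Delta> (Suc i) *\<^sub>v (t @\<^sub>v - z)" by (simp add: fxy)
    moreover have "t @\<^sub>v - z \<in> poly_vecs n (length (cone_degrees E \<delta> K (Suc (Suc i))))"
      using poly_vecs_append[OF t z'] by (simp add: N K''_Suc)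
    ultimately show "f \<in> ?L" by blast
  qed
  have "resolves {a + m * b |a b. a \<in> J \<and> b \<in> poly_ring n} (cone_degrees E \<delta> K) \<Delta>"
    unfolding resolves_def using \<Delta> image exact by (auto simp: cone_degrees_def E0)
  with \<Delta>_min show ?thesis by blast
qed

end

section \<open>Squarefree monomial ideals\<close>

lemma poly_mapping_eq_sum_singles:
  fixes p :: "'k::field mpoly"
  shows "p = (\<Sum>w\<in>Poly_Mapping.keys p. Poly_Mapping.single w (Poly_Mapping.lookup p w))"
  by (rule poly_mapping_eqI) (auto simp: lookup_sum lookup_single when_def in_keys_iff)

lemma lookup_single_mult:
  fixes y :: "'k::field mpoly"
  shows "Poly_Mapping.lookup (Poly_Mapping.single t c * y) (t + w) = c * Poly_Mapping.lookup y w"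
proof -
  have "Poly_Mapping.lookup (Poly_Mapping.single t c * y) (t + w) =
      Sum_any (\<lambda>l. (c * Sum_any (\<lambda>q. Poly_Mapping.lookup y q when t + w = l + q)) when t = l)"
    by (simp add: lookup_mult lookup_single when_mult)
  then show ?thesis by simp
qed

lemma keys_single_mult:
  fixes y :: "'k::field mpoly"
  shows "Poly_Mapping.keys (Poly_Mapping.single t 1 * y) = (+) t ` Poly_Mapping.keys y"
proof
  show "(+) t ` Poly_Mapping.keys y \<subseteq> Poly_Mapping.keys (Poly_Mapping.single t 1 * y)"
    by (auto simp: in_keys_iff lookup_single_mult)
  show "Poly_Mapping.keys (Poly_Mapping.single t 1 * y) \<subseteq> (+) t ` Poly_Mapping.keys y"
    using Poly_Mapping.keys_mult[of "Poly_Mapping.single t 1" y] by auto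
qed

definition sqfree :: "nat set \<Rightarrow> monomial" where
  "sqfree S = (\<Sum>c\<in>S. X c)"

lemma lookup_sqfree: "finite S \<Longrightarrow> Poly_Mapping.lookup (sqfree S) c = (if c \<in> S then 1 else 0)"
  by (simp add: sqfree_def lookup_sum X_def lookup_single when_def)

lemma keys_sqfree: "finite S \<Longrightarrow> Poly_Mapping.keys (sqfree S) = S"
  by (auto simp: in_keys_iff lookup_sqfree split: if_splits)

lemma mdeg_sqfree: "finite S \<Longrightarrow> mdeg (sqfree S) = card S"
  by (simp add: mdeg_def keys_sqfree lookup_sqfree)

lemma sqfree_add_diff: "finite S \<Longrightarrow> S \<subseteq> Poly_Mapping.keys w \<Longrightarrow> sqfree S + (w - sqfree S) = w"
  by (rule poly_mapping_eqI)
    (auto simp: lookup_add lookup_minus lookup_sqfree in_keys_iff subset_iff Suc_le_eq)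

text \<open>The ideal generated by the squarefree monomials with supports in \<open>F\<close>. A squarefree monomial
  divides \<open>w\<close> if and only if its support is contained in that of \<open>w\<close>, so membership depends only
  on the supports of the terms, and colon ideals become statements about finite sets.\<close>

definition support_ideal :: "nat \<Rightarrow> nat set set \<Rightarrow> 'k::field mpoly set" where
  "support_ideal n F = {p \<in> poly_ring n. \<forall>w\<in>Poly_Mapping.keys p. \<exists>S\<in>F. S \<subseteq> Poly_Mapping.keys w}"

lemma support_ideal_add: "p \<in> support_ideal n F \<Longrightarrow> q \<in> support_ideal n F \<Longrightarrow> p + q \<in> support_ideal n F"
  using Poly_Mapping.keys_add[of p q] by (auto simp: support_ideal_def poly_ring_add)

lemma support_ideal_sum: "(\<And>x. x \<in> A \<Longrightarrow> f x \<in> support_ideal n F) \<Longrightarrow> sum f A \<in> support_ideal n F"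
proof (induction A rule: infinite_finite_induct)
  case (insert x A)
  then show ?case by (simp add: support_ideal_add)
qed (simp_all add: support_ideal_def)

lemma sqfree_mult_in_support_ideal:
  assumes "S \<in> F" "finite S" "S \<subseteq> {1..n}" "p \<in> poly_ring n"
  shows "Poly_Mapping.single (sqfree S) 1 * p \<in> support_ideal n F"
  using assms
  by (auto simp: support_ideal_def keys_single_mult keys_add_monomial keys_sqfree monomials_def
      intro!: poly_ring_mult poly_ring_single)

lemma support_ideal_insert:
  assumes T: "T \<subseteq> {1..n}"
  shows "support_ideal n (insert T F) =
    {a + Poly_Mapping.single (sqfree T) 1 * b |a b. a \<in> support_ideal n F \<and> b \<in> poly_ring n}"
    (is "?L = ?R")
proof (intro equalityI subsetI)
  have fin: "finite T" using T finite_subset by blast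
  fix p :: "'a mpoly" assume p: "p \<in> ?L"
  have add: "p + q \<in> ?R" if pq: "p \<in> ?R" "q \<in> ?R" for p q
  proof -
    obtain a b a' b' where "p = a + Poly_Mapping.single (sqfree T) 1 * b" "a \<in> support_ideal n F" "b \<in> poly_ring n"
       "q = a' + Poly_Mapping.single (sqfree T) 1 * b'" "a' \<in> support_ideal n F" "b' \<in> poly_ring n"
      using pq by blast
    then have "p + q = (a + a') + Poly_Mapping.single (sqfree T) 1 * (b + b') \<and>
       a + a' \<in> support_ideal n F \<and> b + b' \<in> poly_ring n"
      by (auto simp: algebra_simps poly_ring_add support_ideal_add)
    then show ?thesis by blast
  qed
  have zero: "0 \<in> ?R"
  proof -
    have "0 = 0 + Poly_Mapping.single (sqfree T) 1 * (0 :: 'a mpoly)" "0 \<in> support_ideal n F"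
      by (auto simp: support_ideal_def)
    then show ?thesis using poly_ring_0 by blast
  qed
  have single: "Poly_Mapping.single w (Poly_Mapping.lookup p w) \<in> ?R" if w: "w \<in> Poly_Mapping.keys p" for w
  proof -
    let ?c = "Poly_Mapping.lookup p w"
    have wn: "w \<in> monomials n" using p w by (auto simp: support_ideal_def poly_ring_def)
    obtain S where S: "S \<in> insert T F" "S \<subseteq> Poly_Mapping.keys w"
      using p w by (auto simp: support_ideal_def)
    show ?thesis
    proof (cases "S \<in> F")
      case True
      then have "Poly_Mapping.single w ?c \<in> support_ideal n F"
        using S wn by (auto simp: support_ideal_def poly_ring_single)
      moreover have "Poly_Mapping.single w ?c = Poly_Mapping.single w ?c + Poly_Mapping.single (sqfree T) 1 * 0"
        by simp
      ultimately show ?thesis using poly_ring_0 by blast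
    next
      case False
      then have w': "sqfree T + (w - sqfree T) = w" using S fin by (intro sqfree_add_diff) auto
      have "Poly_Mapping.single w ?c = 0 + Poly_Mapping.single (sqfree T) 1 * Poly_Mapping.single (w - sqfree T) ?c"
        by (simp add: mult_single w')
      moreover have "w - sqfree T \<in> monomials n" using w' wn add_in_monomials_iff by metis
      then have "Poly_Mapping.single (w - sqfree T) ?c \<in> poly_ring n" by (rule poly_ring_single)
      moreover have "0 \<in> support_ideal n F" by (simp add: support_ideal_def)
      ultimately show ?thesis by blast
    qed
  qed
  have "(\<Sum>w\<in>A. Poly_Mapping.single w (Poly_Mapping.lookup p w)) \<in> ?R"
    if "finite A" "A \<subseteq> Poly_Mapping.keys p" for A
    using that
  proof (induction A rule: finite_induct)
    case empty
    show ?case unfolding sum.empty by (rule zero)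
  next
    case (insert w A)
    show ?case unfolding sum.insert[OF insert.hyps] by (rule add) (use single insert in blast)+
  qed
  from this[of "Poly_Mapping.keys p"] show "p \<in> ?R"
    unfolding poly_mapping_eq_sum_singles[symmetric] by simp
next
  have fin: "finite T" using T finite_subset by blast
  fix p :: "'a mpoly" assume "p \<in> ?R"
  then obtain a b where p: "p = a + Poly_Mapping.single (sqfree T) 1 * b"
    and a: "a \<in> support_ideal n F" and b: "b \<in> poly_ring n" by blast
  show "p \<in> ?L"
    unfolding p
    by (rule support_ideal_add[OF _ sqfree_mult_in_support_ideal[OF _ fin T b]])
      (use a in \<open>auto simp: support_ideal_def\<close>)
qed

text \<open>The support of a product of monomials is the union of the supports; so the colon ideal by the
  monomial with support \<open>T\<close> is obtained by adding \<open>T\<close> to the supports that are tested.\<close>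

lemma support_ideal_colon:
  assumes "finite T" "T \<subseteq> {1..n}" "y \<in> poly_ring n"
    and "\<And>U. U \<subseteq> {1..n} \<Longrightarrow> (\<exists>S\<in>F. S \<subseteq> T \<union> U) \<longleftrightarrow> (\<exists>S\<in>F'. S \<subseteq> U)"
  shows "Poly_Mapping.single (sqfree T) 1 * y \<in> support_ideal n F \<longleftrightarrow> y \<in> support_ideal n F'"
proof -
  have "Poly_Mapping.single (sqfree T) 1 * y \<in> poly_ring n"
    using assms(1-3) by (intro poly_ring_mult poly_ring_single) (auto simp: monomials_def keys_sqfree)
  moreover have "Poly_Mapping.keys w \<subseteq> {1..n}" if "w \<in> Poly_Mapping.keys y" for w
    using assms(3) that by (auto simp: poly_ring_def monomials_def)
  ultimately show ?thesis
    using assms by (auto simp: support_ideal_def keys_single_mult keys_add_monomial keys_sqfree)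
qed

lemma monomial_ideal_eq_support_ideal:
  assumes F: "\<And>S. S \<in> F \<Longrightarrow> S \<subseteq> {1..n}"
  shows "monomial_ideal n (sqfree ` F) = (support_ideal n F :: 'k::field mpoly set)"
proof (intro equalityI subsetI)
  have fin: "finite S" if "S \<in> F" for S using F[OF that] finite_subset by blast
  fix p :: "'k mpoly" assume "p \<in> monomial_ideal n (sqfree ` F)"
  then obtain T c where p: "p = (\<Sum>g\<in>T. c g * g)"
    and T: "T \<subseteq> (\<lambda>w. Poly_Mapping.single w 1) ` sqfree ` F" "\<forall>g\<in>T. c g \<in> poly_ring n"
    unfolding monomial_ideal_def ideal_generated_def by blast
  show "p \<in> support_ideal n F"
    unfolding p
  proof (rule support_ideal_sum)
    fix g assume g: "g \<in> T"
    then obtain S where S: "S \<in> F" "g = Poly_Mapping.single (sqfree S) 1" using T by blast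
    have "g * c g \<in> support_ideal n F"
      unfolding S(2) using S T g by (intro sqfree_mult_in_support_ideal fin F) auto
    then show "c g * g \<in> support_ideal n F" by (simp add: mult.commute)
  qed
next
  have fin: "finite S" if "S \<in> F" for S using F[OF that] finite_subset by blast
  let ?M = "monomial_ideal n (sqfree ` F) :: 'k mpoly set"
  fix p :: "'k mpoly" assume p: "p \<in> support_ideal n F"
  have add: "p + q \<in> ?M" if pM: "p \<in> ?M" and qM: "q \<in> ?M" for p q
  proof -
    let ?G = "(\<lambda>w. Poly_Mapping.single w (1::'k)) ` sqfree ` F"
    obtain T c where p: "p = (\<Sum>g\<in>T. c g * g)" "finite T" "T \<subseteq> ?G" "\<forall>g\<in>T. c g \<in> poly_ring n"
      using pM unfolding monomial_ideal_def ideal_generated_def by blast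
    obtain T' c' where q: "q = (\<Sum>g\<in>T'. c' g * g)" "finite T'" "T' \<subseteq> ?G" "\<forall>g\<in>T'. c' g \<in> poly_ring n"
      using qM unfolding monomial_ideal_def ideal_generated_def by blast
    define e where "e g = (if g \<in> T then c g else 0) + (if g \<in> T' then c' g else 0)" for g
    have "p = (\<Sum>g\<in>T \<union> T'. (if g \<in> T then c g else 0) * g)"
      unfolding p(1) using p(2) q(2) by (intro sum.mono_neutral_cong_left) auto
    moreover have "q = (\<Sum>g\<in>T \<union> T'. (if g \<in> T' then c' g else 0) * g)"
      unfolding q(1) using p(2) q(2) by (intro sum.mono_neutral_cong_left) auto
    ultimately have "p + q = (\<Sum>g\<in>T \<union> T'. e g * g)"
      by (simp add: e_def distrib_right sum.distrib)
    moreover have "\<forall>g\<in>T \<union> T'. e g \<in> poly_ring n"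
      using p(4) q(4) by (auto simp: e_def poly_ring_add)
    moreover have "finite (T \<union> T')" "T \<union> T' \<subseteq> ?G" using p q by auto
    ultimately show ?thesis unfolding monomial_ideal_def ideal_generated_def by blast
  qed
  have zero: "0 \<in> ?M"
    unfolding monomial_ideal_def ideal_generated_def by (auto intro!: exI[of _ "{}"])
  have single: "Poly_Mapping.single w (Poly_Mapping.lookup p w) \<in> ?M" if w: "w \<in> Poly_Mapping.keys p" for w
  proof -
    let ?c = "Poly_Mapping.lookup p w"
    have wn: "w \<in> monomials n" using p w by (auto simp: support_ideal_def poly_ring_def)
    obtain S where S: "S \<in> F" "S \<subseteq> Poly_Mapping.keys w"
      using p w by (auto simp: support_ideal_def)
    have w': "sqfree S + (w - sqfree S) = w" using S fin by (intro sqfree_add_diff) auto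
    let ?g = "Poly_Mapping.single (sqfree S) (1::'k)"
    have "w - sqfree S \<in> monomials n" using w' wn add_in_monomials_iff by metis
    then have "Poly_Mapping.single (w - sqfree S) ?c \<in> poly_ring n" by (rule poly_ring_single)
    moreover have "Poly_Mapping.single w ?c = (\<Sum>g\<in>{?g}. Poly_Mapping.single (w - sqfree S) ?c * g)"
      by (simp add: mult_single add.commute[of "w - sqfree S"] w')
    ultimately show ?thesis
      using S(1) unfolding monomial_ideal_def ideal_generated_def
      by (intro CollectI exI[of _ "{?g}"] exI[of _ "\<lambda>_. Poly_Mapping.single (w - sqfree S) ?c"]) auto
  qed
  have "(\<Sum>w\<in>A. Poly_Mapping.single w (Poly_Mapping.lookup p w)) \<in> ?M"
    if "finite A" "A \<subseteq> Poly_Mapping.keys p" for A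
    using that by (induction A rule: finite_induct) (auto simp: zero intro!: add single)
  from this[of "Poly_Mapping.keys p"] show "p \<in> ?M"
    unfolding poly_mapping_eq_sum_singles[symmetric] by simp
qed

context grading
begin

definition minimally_resolved :: "'k::field mpoly set \<Rightarrow> (nat \<Rightarrow> 'g list) \<Rightarrow> bool" where
  "minimally_resolved I E \<longleftrightarrow> (\<exists>D. resolves I E D \<and> (\<forall>i. no_const_terms (D i)))"

lemma minimally_resolved_0: "minimally_resolved I E \<Longrightarrow> E 0 = [0]"
  by (auto simp: minimally_resolved_def resolves_def)

lemma minimally_resolved_zero_ideal:
  "minimally_resolved (support_ideal n {} :: 'k::field mpoly set) (\<lambda>i. if i = 0 then [0] else [])"
proof -
  let ?E = "\<lambda>i::nat. if i = 0 then [0 :: 'g] else []"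
  let ?D = "\<lambda>i. 0\<^sub>m (length (?E i)) 0 :: 'k mpoly mat"
  have ideal: "support_ideal n {} = {0 :: 'k mpoly}"
    by (auto simp: support_ideal_def)
  have vecs: "poly_vecs n 0 = {0\<^sub>v 0 :: 'k mpoly vec}"
    by (auto simp: poly_vecs_def)
  have "0\<^sub>m k 0 *\<^sub>v vNil = (0\<^sub>v k :: 'k mpoly vec)" for k
    by (rule eq_vecI) (auto simp: scalar_prod_def)
  moreover have "?D i \<in> gmaps (?E (Suc i)) (?E i)" for i
    using gmaps_zero[of "?E i" "?E (Suc i)"] by simp
  ultimately have "resolves (support_ideal n {}) ?E ?D"
    by (auto simp: resolves_def ideal vecs)
  then show ?thesis
    unfolding minimally_resolved_def by (intro exI[of _ ?D]) (auto simp: no_const_terms_def)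
qed

text \<open>One step of the construction: a mapping cone adds a generator to a squarefree monomial ideal.\<close>

lemma minimally_resolved_insert:
  assumes "minimally_resolved (support_ideal n F :: 'k::field mpoly set) E"
    and "minimally_resolved (support_ideal n F' :: 'k mpoly set) K"
    and T: "T \<subseteq> {1..n}"
    and colon: "\<And>U. U \<subseteq> {1..n} \<Longrightarrow> (\<exists>S\<in>F. S \<subseteq> T \<union> U) \<longleftrightarrow> (\<exists>S\<in>F'. S \<subseteq> U)"
    and disjoint: "\<And>i. set (E i) \<inter> (+) (deg (sqfree T)) ` set (K i) = {}"
  shows "minimally_resolved (support_ideal n (insert T F) :: 'k mpoly set)
    (cone_degrees E (deg (sqfree T)) K)"
proof -
  have fin: "finite T" using T finite_subset by blast
  obtain D where D: "resolves (support_ideal n F :: 'k mpoly set) E D" "\<And>i. no_const_terms (D i)"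
    using assms(1) by (auto simp: minimally_resolved_def)
  obtain C where C: "resolves (support_ideal n F' :: 'k mpoly set) K C" "\<And>i. no_const_terms (C i)"
    using assms(2) by (auto simp: minimally_resolved_def)
  have "homog (deg (sqfree T)) (Poly_Mapping.single (sqfree T) 1 :: 'k mpoly)"
    by (simp add: homog_def)
  moreover have "(Poly_Mapping.single (sqfree T) 1 :: 'k mpoly) \<in> poly_ring n"
    using T fin by (intro poly_ring_single) (simp add: monomials_def keys_sqfree)
  ultimately show ?thesis
    unfolding minimally_resolved_def support_ideal_insert[OF T]
    by (rule mapping_cone[OF D C _ _ support_ideal_colon[OF fin T _ colon] disjoint])
qed

end

lemma mdeg_eq_sum:
  fixes w :: monomial
  assumes "finite A" "Poly_Mapping.keys w \<subseteq> A"
  shows "mdeg w = (\<Sum>i\<in>A. Poly_Mapping.lookup w i)"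
  unfolding mdeg_def using assms by (intro sum.mono_neutral_left) (auto simp: in_keys_iff)

lemma mdeg_add: "mdeg (v + w) = mdeg v + mdeg w"
proof -
  let ?A = "Poly_Mapping.keys v \<union> Poly_Mapping.keys w"
  have "mdeg (v + w) = (\<Sum>i\<in>?A. Poly_Mapping.lookup (v + w) i)"
    by (rule mdeg_eq_sum) (auto simp: keys_add_monomial)
  also have "\<dots> = (\<Sum>i\<in>?A. Poly_Mapping.lookup v i) + (\<Sum>i\<in>?A. Poly_Mapping.lookup w i)"
    by (simp add: lookup_add sum.distrib)
  also have "\<dots> = mdeg v + mdeg w"
    by (simp add: mdeg_eq_sum[of ?A v] mdeg_eq_sum[of ?A w])
  finally show ?thesis .
qed

section \<open>Adding generators one at a time\<close>

text \<open>The second degree, the exponent of \<open>x\<^sub>j\<close>, separates basis elements of equal total degree in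
  the mapping cones that produce nonlinear syzygies.\<close>

locale edge_bigrading =
  fixes n j :: nat
begin

definition bideg :: "monomial \<Rightarrow> int \<times> int" where
  "bideg w = (int (mdeg w), int (Poly_Mapping.lookup w j))"

sublocale grading n bideg
  by unfold_locales (simp add: bideg_def mdeg_add lookup_add)

lemma bideg_sqfree: "finite S \<Longrightarrow> bideg (sqfree S) = (int (card S), if j \<in> S then 1 else 0)"
  by (simp add: bideg_def mdeg_sqfree lookup_sqfree)

lemma cone_degrees_0: "cone_degrees E \<delta> K 0 = E 0"
  by (simp add: cone_degrees_def)

lemma set_cone_degrees_Suc:
  "set (cone_degrees E \<delta> K (Suc k)) = set (E (Suc k)) \<union> (+) \<delta> ` set (K k)"
  by (simp add: cone_degrees_def)

text \<open>Ideals generated by variables have linear resolutions, namely Koszul complexes. They arise as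
  iterated mapping cones because a further variable is a nonzerodivisor modulo the previous ones:
  the colon ideal is the given ideal itself.\<close>

lemma variables_resolution:
  assumes "finite Z" "Z \<subseteq> {1..n}"
  shows "\<exists>E. minimally_resolved (support_ideal n ((\<lambda>z. {z}) ` Z) :: 'k::field mpoly set) E \<and>
    (\<forall>k. \<forall>a\<in>set (E k). fst a = int k \<and> (j \<notin> Z \<longrightarrow> snd a = 0))"
  using assms
proof (induction Z rule: finite_induct)
  case empty
  show ?case
    using minimally_resolved_zero_ideal[where 'k = 'k] by (intro exI conjI) auto
next
  case (insert z Z)
  then obtain E where E: "minimally_resolved (support_ideal n ((\<lambda>z. {z}) ` Z) :: 'k mpoly set) E"
    and deg: "\<And>k a. a \<in> set (E k) \<Longrightarrow> fst a = int k \<and> (j \<notin> Z \<longrightarrow> snd a = 0)" by auto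
  have \<delta>: "bideg (sqfree {z}) = (1, if j = z then 1 else 0)" by (simp add: bideg_sqfree)
  have "minimally_resolved (support_ideal n (insert {z} ((\<lambda>z. {z}) ` Z)) :: 'k mpoly set)
      (cone_degrees E (bideg (sqfree {z})) E)"
  proof (rule minimally_resolved_insert[OF E E])
    show "{z} \<subseteq> {1..n}" using insert by simp
    show "(\<exists>S\<in>(\<lambda>z. {z}) ` Z. S \<subseteq> {z} \<union> U) \<longleftrightarrow> (\<exists>S\<in>(\<lambda>z. {z}) ` Z. S \<subseteq> U)" for U
      using insert by auto
    show "set (E i) \<inter> (+) (bideg (sqfree {z})) ` set (E i) = {}" for i
    proof (rule ccontr)
      assume "\<not> ?thesis"
      then obtain a where a: "bideg (sqfree {z}) + a \<in> set (E i)" "a \<in> set (E i)" by auto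
      show False using deg[OF a(1)] deg[OF a(2)] by (simp add: \<delta>)
    qed
  qed
  moreover have "fst a = int k \<and> (j \<notin> insert z Z \<longrightarrow> snd a = 0)"
    if aN: "a \<in> set (cone_degrees E (bideg (sqfree {z})) E k)" for k a
  proof (cases "a \<in> set (E k)")
    case True
    then show ?thesis using deg[of a k] by simp
  next
    case False
    then obtain k' b where "k = Suc k'" and b: "b \<in> set (E k')" "a = bideg (sqfree {z}) + b"
      using aN by (cases k) (auto simp: cone_degrees_0 set_cone_degrees_Suc)
    then show ?thesis using deg[OF b(1)] by (auto simp: \<delta>)
  qed
  ultimately show ?case by auto
qed

text \<open>The colon ideals that occur beyond those generated by variables. Adding \<open>x\<^sub>j x\<^sub>y\<close> has a colon
  ideal generated by the variables in \<open>Z\<close> and the earlier ones in \<open>Y\<close>, none of which is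
  \<open>x\<^sub>j\<close>. So a basis element beyond the linear strand always contains exactly one factor \<open>x\<^sub>j\<close>, and
  one on the linear strand contains none.\<close>

lemma variables_and_pencil_resolution:
  assumes "finite Y" "Y \<subseteq> {1..n}" and Z: "finite Z" "Z \<subseteq> {1..n}"
    and "Y \<inter> Z = {}" "j \<notin> Y" "j \<notin> Z" "j \<in> {1..n}"
  shows "\<exists>E. minimally_resolved
      (support_ideal n ((\<lambda>z. {z}) ` Z \<union> (\<lambda>y. {j, y}) ` Y) :: 'k::field mpoly set) E \<and>
    (\<forall>k. \<forall>a\<in>set (E k). a = (int k, 0) \<or> a = (int k + 1, 1)) \<and>
    (Y \<noteq> {} \<longrightarrow> (2, 1) \<in> set (E 1))"
  using assms(1,2,5,6)
proof (induction Y rule: finite_induct)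
  case empty
  obtain E where "minimally_resolved (support_ideal n ((\<lambda>z. {z}) ` Z) :: 'k mpoly set) E"
    "\<forall>k. \<forall>a\<in>set (E k). fst a = int k \<and> (j \<notin> Z \<longrightarrow> snd a = 0)"
    using variables_resolution[OF Z] by blast
  then show ?case using \<open>j \<notin> Z\<close> by (intro exI[of _ E]) (auto simp: prod_eq_iff)
next
  case (insert y Y)
  let ?F = "(\<lambda>z. {z}) ` Z \<union> (\<lambda>y. {j, y}) ` Y"
  have "\<exists>E. minimally_resolved (support_ideal n ?F :: 'k mpoly set) E \<and>
      (\<forall>k. \<forall>a\<in>set (E k). a = (int k, 0) \<or> a = (int k + 1, 1)) \<and> (Y \<noteq> {} \<longrightarrow> (2, 1) \<in> set (E 1))"
    using insert by simp
  then obtain E where E: "minimally_resolved (support_ideal n ?F :: 'k mpoly set) E"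
    and degE: "\<And>k a. a \<in> set (E k) \<Longrightarrow> a = (int k, 0) \<or> a = (int k + 1, 1)" by blast
  have "\<exists>K. minimally_resolved (support_ideal n ((\<lambda>z. {z}) ` (Z \<union> Y)) :: 'k mpoly set) K \<and>
      (\<forall>k. \<forall>a\<in>set (K k). fst a = int k \<and> (j \<notin> Z \<union> Y \<longrightarrow> snd a = 0))"
    using insert Z by (intro variables_resolution) auto
  then obtain K where K: "minimally_resolved (support_ideal n ((\<lambda>z. {z}) ` (Z \<union> Y)) :: 'k mpoly set) K"
    and degK': "\<And>k a. a \<in> set (K k) \<Longrightarrow> fst a = int k \<and> (j \<notin> Z \<union> Y \<longrightarrow> snd a = 0)" by blast
  have degK: "a = (int k, 0)" if "a \<in> set (K k)" for k a
    using degK'[OF that] insert.prems \<open>j \<notin> Z\<close> by (simp add: prod_eq_iff)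
  have "y \<noteq> j" using insert by auto
  then have \<delta>: "bideg (sqfree {j, y}) = (2, 1)" by (simp add: bideg_sqfree)
  let ?N = "cone_degrees E (bideg (sqfree {j, y})) K"
  have "minimally_resolved (support_ideal n (insert {j, y} ?F) :: 'k mpoly set) ?N"
  proof (rule minimally_resolved_insert[OF E K])
    show "{j, y} \<subseteq> {1..n}" using insert \<open>j \<in> {1..n}\<close> by auto
    show "(\<exists>S\<in>?F. S \<subseteq> {j, y} \<union> U) \<longleftrightarrow> (\<exists>S\<in>(\<lambda>z. {z}) ` (Z \<union> Y). S \<subseteq> U)" for U
      using insert.hyps insert.prems(2,3) \<open>j \<notin> Z\<close> by (simp add: bex_Un) blast
    show "set (E i) \<inter> (+) (bideg (sqfree {j, y})) ` set (K i) = {}" for i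
    proof (rule ccontr)
      assume "\<not> ?thesis"
      then obtain a where a: "bideg (sqfree {j, y}) + a \<in> set (E i)" "a \<in> set (K i)" by auto
      show False using degE[OF a(1)] degK[OF a(2)] by (simp add: \<delta>)
    qed
  qed
  moreover have "a = (int k, 0) \<or> a = (int k + 1, 1)" if aN: "a \<in> set (?N k)" for k a
  proof (cases "a \<in> set (E k)")
    case True
    then show ?thesis by (rule degE)
  next
    case False
    then obtain k' b where "k = Suc k'" and b: "b \<in> set (K k')" "a = bideg (sqfree {j, y}) + b"
      using aN by (cases k) (auto simp: cone_degrees_0 set_cone_degrees_Suc)
    then show ?thesis using degK[OF b(1)] by (auto simp: \<delta>)
  qed
  moreover have "(2, 1) \<in> set (?N 1)"
    using minimally_resolved_0[OF K] by (simp add: set_cone_degrees_Suc \<delta> zero_prod_def)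
  ultimately show ?case
    by (intro exI[of _ ?N]) simp
qed

text \<open>The type argument only fixes the coefficient field, which cannot be read off from \<open>F\<close>.\<close>

definition linearly_resolved :: "'k::field itself \<Rightarrow> nat set set \<Rightarrow> bool" where
  "linearly_resolved _ F \<longleftrightarrow> (\<exists>E. minimally_resolved (support_ideal n F :: 'k mpoly set) E \<and>
    (\<forall>k. \<forall>a\<in>set (E (Suc k)). fst a = int k + 2))"

lemma linearly_resolved_empty: "linearly_resolved TYPE('k::field) {}"
  unfolding linearly_resolved_def
  using minimally_resolved_zero_ideal[where 'k = 'k] by (intro exI conjI) auto

text \<open>A quadratic generator whose colon ideal is generated by variables contributes the degrees
  \<open>k + 2\<close> of a shifted Koszul complex, while the resolution so far has degrees at most \<open>k + 1\<close> in the
  same homological position. So the cone is minimal, and it stays linear.\<close>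

lemma linearly_resolved_insert:
  assumes "linearly_resolved TYPE('k::field) F"
    and T: "T \<subseteq> {1..n}" "card T = 2" and Z: "Z \<subseteq> {1..n}"
    and colon: "\<And>U. U \<subseteq> {1..n} \<Longrightarrow> (\<exists>S\<in>F. S \<subseteq> T \<union> U) \<longleftrightarrow> (\<exists>z\<in>Z. z \<in> U)"
  shows "linearly_resolved TYPE('k) (insert T F)"
proof -
  have fin: "finite T" "finite Z" using T Z finite_subset by blast+
  obtain E where E: "minimally_resolved (support_ideal n F :: 'k mpoly set) E"
    and degE: "\<And>k a. a \<in> set (E (Suc k)) \<Longrightarrow> fst a = int k + 2"
    using assms(1) by (auto simp: linearly_resolved_def)
  obtain K where K: "minimally_resolved (support_ideal n ((\<lambda>z. {z}) ` Z) :: 'k mpoly set) K"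
    and degK: "\<And>k a. a \<in> set (K k) \<Longrightarrow> fst a = int k"
    using variables_resolution[OF fin(2) Z] by blast
  have \<delta>: "fst (bideg (sqfree T)) = 2" using fin T by (simp add: bideg_sqfree)
  let ?N = "cone_degrees E (bideg (sqfree T)) K"
  have "minimally_resolved (support_ideal n (insert T F) :: 'k mpoly set) ?N"
  proof (rule minimally_resolved_insert[OF E K T(1)])
    show "(\<exists>S\<in>F. S \<subseteq> T \<union> U) \<longleftrightarrow> (\<exists>S\<in>(\<lambda>z. {z}) ` Z. S \<subseteq> U)" if "U \<subseteq> {1..n}" for U
      using colon[OF that] by simp
    show "set (E i) \<inter> (+) (bideg (sqfree T)) ` set (K i) = {}" for i
    proof -
      have "fst a \<noteq> int i + 2" if "a \<in> set (E i)" for a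
        using that degE[of a "i - 1"] minimally_resolved_0[OF E] by (cases i) auto
      moreover have "fst a = int i + 2" if "a \<in> (+) (bideg (sqfree T)) ` set (K i)" for a
      proof -
        from that obtain b where "b \<in> set (K i)" "a = bideg (sqfree T) + b" by blast
        then show ?thesis using degK[of b i] \<delta> by simp
      qed
      ultimately show ?thesis by blast
    qed
  qed
  moreover have "fst a = int k + 2" if aN: "a \<in> set (?N (Suc k))" for k a
  proof -
    consider "a \<in> set (E (Suc k))" | b where "b \<in> set (K k)" "a = bideg (sqfree T) + b"
      using aN by (auto simp: set_cone_degrees_Suc)
    then show ?thesis
    proof cases
      case 1
      then show ?thesis by (rule degE)
    next
      case 2
      then show ?thesis using degK[of b k] \<delta> by simp
    qed
  qed
  ultimately show ?thesis
    unfolding linearly_resolved_def by blast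
qed

text \<open>Beyond the linear strand only the next strand is allowed, and there only with \<open>x\<^sub>j\<close> to the first
  power. The flag records that a first syzygy of total degree 4 occurs.\<close>

definition almost_linearly_resolved :: "'k::field itself \<Rightarrow> nat set set \<Rightarrow> bool \<Rightarrow> bool" where
  "almost_linearly_resolved _ F b \<longleftrightarrow>
    (\<exists>E. minimally_resolved (support_ideal n F :: 'k mpoly set) E \<and>
      (\<forall>k. \<forall>a\<in>set (E (Suc k)). fst a = int k + 2 \<or> a = (int k + 3, 1)) \<and>
      (b \<longrightarrow> (4, 1) \<in> set (E 2)))"

text \<open>The shifted resolution of the colon ideal and the resolution so far can both have basis elements
  of total degree \<open>k + 2\<close> in position \<open>k\<close>. They do not cancel in the cone: the former do not contain \<open>x\<^sub>j\<close>,
  because neither the new generator \<open>T\<close> nor \<open>Z\<close> does, and the latter contain it once. The generators \<open>x\<^sub>j x\<^sub>y\<close>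
  of the colon ideal yield first syzygies of degree 4.\<close>

lemma almost_linearly_resolved_insert:
  assumes "almost_linearly_resolved TYPE('k::field) F b"
    and T: "T \<subseteq> {1..n}" "card T = 2" "j \<notin> T" and Z: "Z \<subseteq> {1..n}" and Y: "Y \<subseteq> {1..n}" "Y \<noteq> {}"
    and j: "Y \<inter> Z = {}" "j \<notin> Y" "j \<notin> Z" "j \<in> {1..n}"
    and colon: "\<And>U. U \<subseteq> {1..n} \<Longrightarrow>
      (\<exists>S\<in>F. S \<subseteq> T \<union> U) \<longleftrightarrow> (\<exists>z\<in>Z. z \<in> U) \<or> (j \<in> U \<and> (\<exists>y\<in>Y. y \<in> U))"
  shows "almost_linearly_resolved TYPE('k) (insert T F) True"
proof -
  have fin: "finite T" "finite Z" "finite Y" using T Z Y finite_subset by blast+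
  let ?F' = "(\<lambda>z. {z}) ` Z \<union> (\<lambda>y. {j, y}) ` Y"
  obtain E where E: "minimally_resolved (support_ideal n F :: 'k mpoly set) E"
    and degE: "\<And>k a. a \<in> set (E (Suc k)) \<Longrightarrow> fst a = int k + 2 \<or> a = (int k + 3, 1)"
    using assms(1) by (auto simp: almost_linearly_resolved_def)
  obtain K where K: "minimally_resolved (support_ideal n ?F' :: 'k mpoly set) K"
    and degK: "\<And>k a. a \<in> set (K k) \<Longrightarrow> a = (int k, 0) \<or> a = (int k + 1, 1)"
    and K1: "(2, 1) \<in> set (K 1)"
    using variables_and_pencil_resolution[OF fin(3) Y(1) fin(2) Z j] Y(2) by blast
  have \<delta>: "bideg (sqfree T) = (2, 0)" using fin T by (simp add: bideg_sqfree)
  let ?N = "cone_degrees E (bideg (sqfree T)) K"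
  have shifted: "a = (int k + 2, 0) \<or> a = (int k + 3, 1)" if "a \<in> (+) (bideg (sqfree T)) ` set (K k)" for k a
  proof -
    from that obtain b where "b \<in> set (K k)" "a = bideg (sqfree T) + b" by blast
    then show ?thesis using degK[of b k] by (auto simp: \<delta>)
  qed
  have "minimally_resolved (support_ideal n (insert T F) :: 'k mpoly set) ?N"
  proof (rule minimally_resolved_insert[OF E K T(1)])
    show "(\<exists>S\<in>F. S \<subseteq> T \<union> U) \<longleftrightarrow> (\<exists>S\<in>?F'. S \<subseteq> U)" if "U \<subseteq> {1..n}" for U
      unfolding colon[OF that] by (auto simp: bex_Un)
    show "set (E i) \<inter> (+) (bideg (sqfree T)) ` set (K i) = {}" for i
    proof -
      have "a \<noteq> (int i + 2, 0) \<and> a \<noteq> (int i + 3, 1)" if "a \<in> set (E i)" for a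
      proof (cases i)
        case 0
        then show ?thesis using that minimally_resolved_0[OF E] by (auto simp: zero_prod_def)
      next
        case (Suc i')
        then show ?thesis using that degE[of a i'] by auto
      qed
      with shifted[of _ i] show ?thesis by blast
    qed
  qed
  moreover have "fst a = int k + 2 \<or> a = (int k + 3, 1)" if aN: "a \<in> set (?N (Suc k))" for k a
  proof (cases "a \<in> set (E (Suc k))")
    case True
    then show ?thesis by (rule degE)
  next
    case False
    then show ?thesis
      using aN shifted[of a k] unfolding set_cone_degrees_Suc by fastforce
  qed
  moreover have "(4, 1) \<in> set (?N 2)"
  proof -
    have "(2, 0) + (2, 1) \<in> (+) (bideg (sqfree T)) ` set (K 1)"
      unfolding \<delta> using K1 by (rule imageI)
    also have "(2, 0) + (2, 1) = (4 :: int, 1 :: int)" by simp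
    finally have "(4, 1) \<in> set (?N (Suc 1))"
      unfolding set_cone_degrees_Suc by (rule UnI2)
    then show ?thesis by (simp only: Suc_1)
  qed
  ultimately show ?thesis
    unfolding almost_linearly_resolved_def by blast
qed

end

section \<open>Colon ideals of the edge ideal\<close>

text \<open>Squarefree quadratic monomials are edges of a graph. These are the edges without the vertex 1
  that precede \<open>{a, b}\<close> in the lexicographic order.\<close>

definition initial_edges :: "nat \<Rightarrow> nat \<Rightarrow> nat \<Rightarrow> nat set set" where
  "initial_edges n a b = {{c, d} |c d. 2 \<le> c \<and> c < d \<and> d \<le> n \<and> (c < a \<or> c = a \<and> d < b)}"

text \<open>The edges at the vertex 1 are added last, from \<open>{1, i}\<close> upwards. With \<open>b = Suc n\<close> the lexsegment is
  complete.\<close>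

definition segment_edges :: "nat \<Rightarrow> nat \<Rightarrow> nat \<Rightarrow> nat \<Rightarrow> nat \<Rightarrow> nat set set" where
  "segment_edges n i j r b = initial_edges n j (Suc r) \<union> {{1, c} |c. i \<le> c \<and> c < b}"

lemma ex_pair_subset:
  "(\<exists>S\<in>{{c, d} |c d. P c d}. S \<subseteq> V) \<longleftrightarrow> (\<exists>c d. P c d \<and> c \<in> V \<and> d \<in> V)"
proof
  assume "\<exists>S\<in>{{c, d} |c d. P c d}. S \<subseteq> V"
  then obtain c d where "P c d" "{c, d} \<subseteq> V" by auto
  then show "\<exists>c d. P c d \<and> c \<in> V \<and> d \<in> V" by auto
next
  assume "\<exists>c d. P c d \<and> c \<in> V \<and> d \<in> V"
  then obtain c d where "P c d" "{c, d} \<subseteq> V" by auto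
  then show "\<exists>S\<in>{{c, d} |c d. P c d}. S \<subseteq> V"
    by (intro bexI[of _ "{c, d}"]) auto
qed

lemma insert_pair:
  assumes "\<And>c d. P' c d \<longleftrightarrow> P c d \<or> c = a \<and> d = b"
  shows "{{c, d} |c d. P' c d} = insert {a, b} {{c, d} |c d. P c d}"
  unfolding assms by auto

lemma ex_initial_edges:
  "(\<exists>S\<in>initial_edges n a b. S \<subseteq> V) \<longleftrightarrow>
    (\<exists>c d. 2 \<le> c \<and> c < d \<and> d \<le> n \<and> (c < a \<or> c = a \<and> d < b) \<and> c \<in> V \<and> d \<in> V)"
  unfolding initial_edges_def ex_pair_subset by (simp only: conj_assoc)

lemma ex_segment_edges:
  "(\<exists>S\<in>segment_edges n i j r b. S \<subseteq> V) \<longleftrightarrow>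
    (\<exists>c d. 2 \<le> c \<and> c < d \<and> d \<le> n \<and> (c < j \<or> c = j \<and> d \<le> r) \<and> c \<in> V \<and> d \<in> V) \<or>
    (\<exists>c. i \<le> c \<and> c < b \<and> 1 \<in> V \<and> c \<in> V)"
proof -
  have "(\<exists>S\<in>{{1, c} |c. i \<le> c \<and> c < b}. S \<subseteq> V) \<longleftrightarrow> (\<exists>c. i \<le> c \<and> c < b \<and> 1 \<in> V \<and> c \<in> V)"
    by auto
  then show ?thesis
    unfolding segment_edges_def bex_Un ex_initial_edges less_Suc_eq_le by (rule arg_cong)
qed

lemma segment_edge_subset_cases:
  assumes "\<exists>S\<in>segment_edges n i j r b. S \<subseteq> V"
  obtains (initial) c d where "2 \<le> c" "c < d" "d \<le> n" "c < j \<or> c = j \<and> d \<le> r" "c \<in> V" "d \<in> V"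
    | (star) c where "i \<le> c" "c < b" "c \<in> V"
proof -
  from assms[unfolded ex_segment_edges] show ?thesis
  proof (rule disjE)
    assume "\<exists>c d. 2 \<le> c \<and> c < d \<and> d \<le> n \<and> (c < j \<or> c = j \<and> d \<le> r) \<and> c \<in> V \<and> d \<in> V"
    then show ?thesis by (elim exE conjE) (rule initial)
  next
    assume "\<exists>c. i \<le> c \<and> c < b \<and> 1 \<in> V \<and> c \<in> V"
    then show ?thesis by (elim exE conjE) (rule star)
  qed
qed

lemma initial_edges_Suc:
  assumes "2 \<le> a" "a < b" "b \<le> n"
  shows "initial_edges n a (Suc b) = insert {a, b} (initial_edges n a b)"
  unfolding initial_edges_def by (rule insert_pair) (use assms in auto)

lemma initial_edges_next_row:
  "initial_edges n (Suc a) (Suc (Suc a)) = initial_edges n a (Suc n)"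
proof -
  have "2 \<le> c \<and> c < d \<and> d \<le> n \<and> (c < Suc a \<or> c = Suc a \<and> d < Suc (Suc a)) \<longleftrightarrow>
      2 \<le> c \<and> c < d \<and> d \<le> n \<and> (c < a \<or> c = a \<and> d < Suc n)" for c d
    by auto
  then show ?thesis unfolding initial_edges_def by (simp only:)
qed

lemma segment_edges_Suc:
  assumes "i \<le> b"
  shows "segment_edges n i j r (Suc b) = insert {1, b} (segment_edges n i j r b)"
proof -
  have "{{1, c} |c. i \<le> c \<and> c < Suc b} = insert {1, b} {{1, c} |c. i \<le> c \<and> c < b}"
    using assms less_Suc_eq by auto
  then show ?thesis unfolding segment_edges_def by (simp only: Un_insert_right)
qed

context edge_bigrading
begin

text \<open>The colon ideal by \<open>x\<^sub>a x\<^sub>b\<close> is generated by the variables with index below \<open>b\<close>, other than \<open>x\<^sub>1\<close>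
  and \<open>x\<^sub>a\<close>: each of them forms with \<open>a\<close> an earlier edge, and each earlier edge contains one of
  them.\<close>

lemma initial_edges_linearly_resolved_row:
  assumes start: "linearly_resolved TYPE('k::field) (initial_edges n a (Suc a))"
    and a: "2 \<le> a" and b: "Suc a \<le> b" "b \<le> Suc n"
  shows "linearly_resolved TYPE('k) (initial_edges n a b)"
  using b
proof (induction b rule: dec_induct)
  case base
  show ?case by (rule start)
next
  case (step b)
  have bn: "b \<le> n" and ab: "a < b" using step by auto
  have colon: "(\<exists>S\<in>initial_edges n a b. S \<subseteq> {a, b} \<union> U) \<longleftrightarrow> (\<exists>z\<in>{2..<b} - {a}. z \<in> U)" for U
  proof
    assume "\<exists>S\<in>initial_edges n a b. S \<subseteq> {a, b} \<union> U"
    then obtain c d where "2 \<le> c" "c < d" "d \<le> n" "c < a \<or> c = a \<and> d < b"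
      "c \<in> {a, b} \<union> U" "d \<in> {a, b} \<union> U"
      unfolding ex_initial_edges by blast
    then show "\<exists>z\<in>{2..<b} - {a}. z \<in> U"
      using ab by (cases "c < a") (auto intro: bexI[of _ c] bexI[of _ d])
  next
    assume "\<exists>z\<in>{2..<b} - {a}. z \<in> U"
    then obtain z where "z \<in> {2..<b} - {a}" and "z \<in> U" by blast
    then have z: "2 \<le> z" "z < b" "z \<noteq> a" "z \<in> U" by auto
    show "\<exists>S\<in>initial_edges n a b. S \<subseteq> {a, b} \<union> U"
      unfolding ex_initial_edges
    proof (cases "z < a")
      case True
      then show "\<exists>c d. 2 \<le> c \<and> c < d \<and> d \<le> n \<and> (c < a \<or> c = a \<and> d < b) \<and> c \<in> {a, b} \<union> U \<and> d \<in> {a, b} \<union> U"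
        using z ab bn by (intro exI[of _ z] exI[of _ a]) auto
    next
      case False
      then show "\<exists>c d. 2 \<le> c \<and> c < d \<and> d \<le> n \<and> (c < a \<or> c = a \<and> d < b) \<and> c \<in> {a, b} \<union> U \<and> d \<in> {a, b} \<union> U"
        using z a bn by (intro exI[of _ a] exI[of _ z]) auto
    qed
  qed
  show ?case
    unfolding initial_edges_Suc[OF a ab bn]
  proof (rule linearly_resolved_insert)
    show "linearly_resolved TYPE('k) (initial_edges n a b)" using step by simp
    show "{a, b} \<subseteq> {1..n}" "card {a, b} = 2" "{2..<b} - {a} \<subseteq> {1..n}"
      using a ab bn by auto
  qed (rule colon)
qed

lemma initial_edges_linearly_resolved:
  assumes "2 \<le> a" "a < b" "b \<le> Suc n"
  shows "linearly_resolved TYPE('k::field) (initial_edges n a b)"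
proof -
  have "linearly_resolved TYPE('k) (initial_edges n a (Suc a))"
    using assms(1) order.trans[OF less_imp_le[OF assms(2)] assms(3)]
  proof (induction a rule: dec_induct)
    case base
    have "initial_edges n 2 3 = {}" by (auto simp: initial_edges_def)
    then show ?case using linearly_resolved_empty[where 'k = 'k] by simp
  next
    case (step a)
    then have "linearly_resolved TYPE('k) (initial_edges n a (Suc a))" "2 \<le> a" "Suc a \<le> Suc n" by auto
    then show ?case
      unfolding initial_edges_next_row by (rule initial_edges_linearly_resolved_row) simp
  qed
  then show ?thesis
    by (rule initial_edges_linearly_resolved_row) (use assms in auto)
qed

text \<open>The colon ideal by \<open>x\<^sub>1 x\<^sub>b\<close> contains the variables of the neighbours of \<open>b\<close> and those of \<open>i, \<dots>, b - 1\<close>,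
  and every earlier edge without the vertex 1 must contain one of these indices. This can fail only for
  \<open>{j, d}\<close> with \<open>j < d \<le> r < b\<close>. These contain \<open>d\<close> with \<open>i \<le> d < b\<close> if
  \<open>i \<le> Suc j\<close>, and there are none if \<open>b \<le> r\<close>.\<close>

lemma segment_edges_linearly_resolved:
  assumes i: "2 \<le> i" and j: "2 \<le> j" "j < r" "r \<le> n"
    and b: "i \<le> b" "b \<le> Suc n" and ok: "b \<le> Suc r \<or> i \<le> Suc j"
  shows "linearly_resolved TYPE('k::field) (segment_edges n i j r b)"
  using b ok
proof (induction b rule: dec_induct)
  case base
  have "segment_edges n i j r i = initial_edges n j (Suc r)"
    by (auto simp: segment_edges_def)
  then show ?case using j by (auto intro: initial_edges_linearly_resolved)
next
  case (step b)
  have bn: "b \<le> n" and ib: "i \<le> b" and ok': "b \<le> r \<or> i \<le> Suc j"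
    using step.hyps step.prems by simp_all
  define Z where "Z = {c \<in> {2..n}. c \<noteq> b \<and> (c < j \<or> b < j \<or> c = j \<and> b \<le> r \<or> b = j \<and> c \<le> r)} \<union> {i..<b}"
  have colon: "(\<exists>S\<in>segment_edges n i j r b. S \<subseteq> {1, b} \<union> U) \<longleftrightarrow> (\<exists>z\<in>Z. z \<in> U)"
    if U: "U \<subseteq> {1..n}" for U
  proof
    assume "\<exists>S\<in>segment_edges n i j r b. S \<subseteq> {1, b} \<union> U"
    then show "\<exists>z\<in>Z. z \<in> U"
    proof (cases rule: segment_edge_subset_cases)
      case (initial c d)
      have "c \<in> U \<and> c \<in> Z \<or> d \<in> U \<and> d \<in> Z"
        using initial ok' ib i j bn unfolding Z_def by auto
      then show ?thesis by blast
    next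
      case (star c)
      then have "c \<in> U \<and> c \<in> Z" using i unfolding Z_def by auto
      then show ?thesis by blast
    qed
  next
    assume "\<exists>z\<in>Z. z \<in> U"
    then obtain z where z: "z \<in> Z" "z \<in> U" by blast
    show "\<exists>S\<in>segment_edges n i j r b. S \<subseteq> {1, b} \<union> U"
      unfolding ex_segment_edges
    proof (cases "z \<in> {i..<b}")
      case False
      then have "2 \<le> min z b \<and> min z b < max z b \<and> max z b \<le> n \<and>
          (min z b < j \<or> min z b = j \<and> max z b \<le> r) \<and> min z b \<in> {1, b} \<union> U \<and> max z b \<in> {1, b} \<union> U"
        using z bn ib i j unfolding Z_def by (auto simp: min_def max_def)
      then show "(\<exists>c d. 2 \<le> c \<and> c < d \<and> d \<le> n \<and> (c < j \<or> c = j \<and> d \<le> r) \<and> c \<in> {1, b} \<union> U \<and> d \<in> {1, b} \<union> U) \<or>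
          (\<exists>c. i \<le> c \<and> c < b \<and> 1 \<in> {1, b} \<union> U \<and> c \<in> {1, b} \<union> U)" by blast
    qed (use z in auto)
  qed
  show ?case
    unfolding segment_edges_Suc[OF ib]
  proof (rule linearly_resolved_insert)
    have "b \<le> Suc r \<or> i \<le> Suc j" using ok' by auto
    then show "linearly_resolved TYPE('k) (segment_edges n i j r b)" using step.IH bn by simp
    show "{1, b} \<subseteq> {1..n}" "card {1, b} = 2" "Z \<subseteq> {1..n}"
      using i ib bn by (auto simp: Z_def)
  qed (rule colon)
qed

text \<open>From \<open>b = max i (Suc r)\<close> on, \<open>b\<close> is not a neighbour of \<open>j\<close>, and the edges \<open>{j, y}\<close> with \<open>j < y \<le> r\<close>
  and \<open>y < i\<close> contain no index of a variable of the colon ideal. They remain as its quadratic generators;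
  \<open>y = j + 1\<close> is always among them. Before that point the resolution is linear.\<close>

lemma segment_edges_almost_linearly_resolved:
  assumes ij: "j + 2 \<le> i" "i \<le> n" and j: "2 \<le> j" "j < r" "r < n"
    and b: "max i (Suc r) \<le> b" "b \<le> Suc n"
  shows "almost_linearly_resolved TYPE('k::field) (segment_edges n i j r b) (max i (Suc r) < b)"
  using b
proof (induction b rule: dec_induct)
  case base
  show ?case
  proof (cases "i \<le> Suc r")
    case True
    then have "linearly_resolved TYPE('k) (segment_edges n i j r (Suc r))"
      using assms by (intro segment_edges_linearly_resolved) auto
    then show ?thesis using True
      by (auto simp: linearly_resolved_def almost_linearly_resolved_def max_def)
  next
    case False
    have "segment_edges n i j r i = initial_edges n j (Suc r)"
      by (auto simp: segment_edges_def)
    then have "linearly_resolved TYPE('k) (segment_edges n i j r i)"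
      using j by (auto intro: initial_edges_linearly_resolved)
    then show ?thesis using False
      by (auto simp: linearly_resolved_def almost_linearly_resolved_def max_def)
  qed
next
  case (step b)
  have bn: "b \<le> n" and ib: "i \<le> b" and rb: "r < b"
    using step.hyps step.prems by simp_all
  let ?Z = "{2..<j} \<union> {i..<b}" and ?Y = "{Suc j..<min i (Suc r)}"
  have colon: "(\<exists>S\<in>segment_edges n i j r b. S \<subseteq> {1, b} \<union> U) \<longleftrightarrow>
      (\<exists>z\<in>?Z. z \<in> U) \<or> (j \<in> U \<and> (\<exists>y\<in>?Y. y \<in> U))"
    if U: "U \<subseteq> {1..n}" for U
  proof
    assume "\<exists>S\<in>segment_edges n i j r b. S \<subseteq> {1, b} \<union> U"
    then show "(\<exists>z\<in>?Z. z \<in> U) \<or> (j \<in> U \<and> (\<exists>y\<in>?Y. y \<in> U))"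
    proof (cases rule: segment_edge_subset_cases)
      case (initial c d)
      have "c \<in> U \<and> c \<in> ?Z \<or> d \<in> U \<and> d \<in> ?Z \<or> j \<in> U \<and> d \<in> ?Y \<and> d \<in> U"
        using initial rb ib ij j by auto
      then show ?thesis by blast
    next
      case (star c)
      then have "c \<in> U \<and> c \<in> ?Z" using ij j by auto
      then show ?thesis by blast
    qed
  next
    assume "(\<exists>z\<in>?Z. z \<in> U) \<or> (j \<in> U \<and> (\<exists>y\<in>?Y. y \<in> U))"
    then consider z where "z \<in> U" "2 \<le> z" "z < j" | z where "z \<in> U" "i \<le> z" "z < b"
      | y where "j \<in> U" "y \<in> U" "j < y" "y \<le> r" by fastforce
    then show "\<exists>S\<in>segment_edges n i j r b. S \<subseteq> {1, b} \<union> U"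
      unfolding ex_segment_edges
    proof cases
      case 1
      then show "(\<exists>c d. 2 \<le> c \<and> c < d \<and> d \<le> n \<and> (c < j \<or> c = j \<and> d \<le> r) \<and> c \<in> {1, b} \<union> U \<and> d \<in> {1, b} \<union> U) \<or>
          (\<exists>c. i \<le> c \<and> c < b \<and> 1 \<in> {1, b} \<union> U \<and> c \<in> {1, b} \<union> U)"
        using ib ij bn by (intro disjI1 exI[of _ z] exI[of _ b]) auto
    next
      case 2
      then show "(\<exists>c d. 2 \<le> c \<and> c < d \<and> d \<le> n \<and> (c < j \<or> c = j \<and> d \<le> r) \<and> c \<in> {1, b} \<union> U \<and> d \<in> {1, b} \<union> U) \<or>
          (\<exists>c. i \<le> c \<and> c < b \<and> 1 \<in> {1, b} \<union> U \<and> c \<in> {1, b} \<union> U)" by blast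
    next
      case 3
      then show "(\<exists>c d. 2 \<le> c \<and> c < d \<and> d \<le> n \<and> (c < j \<or> c = j \<and> d \<le> r) \<and> c \<in> {1, b} \<union> U \<and> d \<in> {1, b} \<union> U) \<or>
          (\<exists>c. i \<le> c \<and> c < b \<and> 1 \<in> {1, b} \<union> U \<and> c \<in> {1, b} \<union> U)"
        using j by (intro disjI1 exI[of _ j] exI[of _ y]) auto
    qed
  qed
  have "almost_linearly_resolved TYPE('k) (insert {1, b} (segment_edges n i j r b)) True"
  proof (rule almost_linearly_resolved_insert)
    show "almost_linearly_resolved TYPE('k) (segment_edges n i j r b) (max i (Suc r) < b)"
      using step by simp
    show "{1, b} \<subseteq> {1..n}" "card {1, b} = 2" "j \<notin> {1, b}" "?Z \<subseteq> {1..n}" "?Y \<subseteq> {1..n}" "?Y \<noteq> {}"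
      "?Y \<inter> ?Z = {}" "j \<notin> ?Y" "j \<notin> ?Z" "j \<in> {1..n}"
      using ij j ib bn by auto
  qed (rule colon)
  then show ?case
    unfolding segment_edges_Suc[OF ib] using step by (simp add: almost_linearly_resolved_def)
qed

end

section \<open>Regularity from a minimal resolution\<close>

context edge_bigrading
begin

sublocale total: grading n "\<lambda>w. int (mdeg w)"
  by unfold_locales (simp add: mdeg_add)

lemma gmaps_forget: "A \<in> gmaps as bs \<Longrightarrow> A \<in> total.gmaps (map fst as) (map fst bs)"
  by (auto simp: gmaps_def total.gmaps_def homog_def total.homog_def bideg_def prod_eq_iff)

lemma resolves_forget:
  assumes "resolves I E D"
  shows "total.resolves I (\<lambda>k. map fst (E k)) D"
  using assms unfolding resolves_def total.resolves_def
  by (auto intro: gmaps_forget simp: zero_prod_def)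

lemma graded_maps_eq: "graded_maps n as bs = total.gmaps as bs"
  by (auto simp: graded_maps_def total.gmaps_def poly_mats_def homogeneous_def total.homog_def)

lemma minimal_graded_free_resolution_iff:
  "minimal_graded_free_resolution n I (d, D) \<longleftrightarrow>
    total.resolves I (case_nat [0] d) D \<and> (\<forall>i. no_const_terms (D (Suc i)))"
proof -
  let ?E = "case_nat [0] d"
  have maps: "D 0 \<in> graded_maps n (d 0) [0] \<and> (\<forall>i. D (Suc i) \<in> graded_maps n (d (Suc i)) (d i)) \<longleftrightarrow>
      (\<forall>i. D i \<in> total.gmaps (?E (Suc i)) (?E i))"
  proof -
    have "(\<forall>i. Q i) \<longleftrightarrow> Q 0 \<and> (\<forall>i. Q (Suc i))" for Q :: "nat \<Rightarrow> bool"
      by (metis not0_implies_Suc)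
    from this[of "\<lambda>i. D i \<in> total.gmaps (?E (Suc i)) (?E i)"] show ?thesis
      by (simp add: graded_maps_eq)
  qed
  show ?thesis
  proof (cases "\<forall>i. D i \<in> total.gmaps (?E (Suc i)) (?E i)")
    case True
    then have carr: "D i \<in> carrier_mat (length (?E i)) (length (d i))" for i
      using total.gmaps_carrier[of "D i" "?E (Suc i)" "?E i"] by simp
    have no_const: "no_const_terms (D (Suc i)) \<longleftrightarrow> (\<forall>t<length (d i). \<forall>s<length (d (Suc i)).
        Poly_Mapping.lookup (D (Suc i) $$ (t, s)) 0 = 0)" for i
      using carr[of "Suc i"] by (auto simp: no_const_terms_def)
    have "dim_row (D i) = length (?E i)" for i using carr[of i] by simp
    then show ?thesis
      using maps True
      by (simp add: minimal_graded_free_resolution_def total.resolves_def free_module_eq_poly_vecs no_const)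
  next
    case False
    then show ?thesis
      using maps by (auto simp: minimal_graded_free_resolution_def total.resolves_def)
  qed
qed

text \<open>Regularity is defined through an arbitrary minimal resolution. By uniqueness the
  degrees that occur in it are the first components of the bidegrees of any minimal bigraded
  resolution.\<close>

lemma regularity_eq_Max:
  assumes "minimally_resolved I E"
  shows "regularity n I = Max {a. \<exists>i. int i + a \<in> fst ` set (E (Suc i))}"
proof -
  obtain D where D: "resolves I E D" and D_min: "\<And>i. no_const_terms (D i)"
    using assms by (auto simp: minimally_resolved_def)
  note R = resolves_forget[OF D]
  have "(\<lambda>k. map fst (E k)) = case_nat [0] (\<lambda>k. map fst (E (Suc k)))"
    using R by (auto simp: total.resolves_def split: nat.split)
  then have "minimal_graded_free_resolution n I (\<lambda>k. map fst (E (Suc k)), D)"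
    unfolding minimal_graded_free_resolution_iff using R D_min by simp
  then have "minimal_graded_free_resolution n I (SOME R. minimal_graded_free_resolution n I R)"
    by (rule someI)
  moreover obtain d D' where dD': "(SOME R. minimal_graded_free_resolution n I R) = (d, D')"
    by fastforce
  ultimately have R': "total.resolves I (case_nat [0] d) D'" "\<And>i. no_const_terms (D' (Suc i))"
    by (auto simp: minimal_graded_free_resolution_iff)
  have "set (d i) = fst ` set (E (Suc i))" for i
    using total.minimal_degrees_subset[OF R' R, of i] total.minimal_degrees_subset[OF R D_min R'(1), of i]
    by auto
  then have "graded_betti n I i a \<noteq> 0 \<longleftrightarrow> a \<in> fst ` set (E (Suc i))" for i a
    by (simp add: graded_betti_def dD' count_list_0_iff)
  then show ?thesis by (simp add: regularity_def)
qed

lemma minimally_resolved_nonzero: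
  fixes I :: "'k::field mpoly set"
  assumes "minimally_resolved I E" "p \<in> I" "p \<noteq> 0"
  shows "E (Suc 0) \<noteq> []"
proof
  assume E1: "E (Suc 0) = []"
  obtain D where D: "resolves I E D" using assms(1) by (auto simp: minimally_resolved_def)
  have D0: "D 0 \<in> carrier_mat 1 0"
    using gmaps_carrier[OF resolves_gmaps[OF D, of 0]] E1 minimally_resolved_0[OF assms(1)] by simp
  obtain f where f: "f \<in> poly_vecs n 0" "p = (D 0 *\<^sub>v f) $ 0"
    using D assms(2) E1 by (auto simp: resolves_def)
  have "p = (\<Sum>k<0. D 0 $$ (0, k) * f $ k)"
    unfolding f(2) by (rule index_mult_vec_sum[OF D0 poly_vecs_carrier[OF f(1)]]) simp
  then show False using assms(3) by simp
qed

text \<open>A generator is required because the zero ideal, too, has a linear resolution.\<close>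

lemma regularity_linearly_resolved:
  assumes F: "linearly_resolved TYPE('k::field) F" and S: "S \<in> F" "S \<subseteq> {1..n}"
  shows "regularity n (support_ideal n F :: 'k mpoly set) = 2"
proof -
  obtain E where E: "minimally_resolved (support_ideal n F :: 'k mpoly set) E"
    and deg: "\<And>k a. a \<in> set (E (Suc k)) \<Longrightarrow> fst a = int k + 2"
    using F by (auto simp: linearly_resolved_def)
  have fin: "finite S" using S finite_subset by blast
  let ?A = "{a. \<exists>i. int i + a \<in> fst ` set (E (Suc i))}"
  have "Poly_Mapping.single (sqfree S) 1 * 1 \<in> (support_ideal n F :: 'k mpoly set)"
    by (rule sqfree_mult_in_support_ideal[OF S(1) fin S(2) poly_ring_1])
  moreover have "Poly_Mapping.single (sqfree S) 1 * 1 \<noteq> (0 :: 'k mpoly)"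
    by (metis keys_single keys_zero insert_not_empty mult.right_neutral zero_neq_one)
  ultimately have "E (Suc 0) \<noteq> []"
    by (rule minimally_resolved_nonzero[OF E])
  then have hd: "hd (E (Suc 0)) \<in> set (E (Suc 0))" by simp
  then have "int 0 + 2 \<in> fst ` set (E (Suc 0))"
    using deg[OF hd] by force
  then have "2 \<in> ?A" by blast
  moreover have "?A \<subseteq> {2}" using deg by fastforce
  ultimately have "?A = {2}" by blast
  then show ?thesis using regularity_eq_Max[OF E] by simp
qed

lemma regularity_almost_linearly_resolved:
  assumes "almost_linearly_resolved TYPE('k::field) F True"
  shows "regularity n (support_ideal n F :: 'k mpoly set) = 3"
proof -
  obtain E where E: "minimally_resolved (support_ideal n F :: 'k mpoly set) E"
    and deg: "\<And>k a. a \<in> set (E (Suc k)) \<Longrightarrow> fst a = int k + 2 \<or> a = (int k + 3, 1)"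
    and four: "(4, 1) \<in> set (E 2)"
    using assms by (auto simp: almost_linearly_resolved_def)
  let ?A = "{a. \<exists>i. int i + a \<in> fst ` set (E (Suc i))}"
  have sub: "?A \<subseteq> {2, 3}" using deg by fastforce
  have three: "3 \<in> ?A"
  proof -
    have "int 1 + 3 = fst (4 :: int, 1 :: int)" by simp
    then have "int 1 + 3 \<in> fst ` set (E (Suc 1))"
      unfolding Suc_1 by (simp only:) (rule imageI[OF four])
    then show ?thesis by blast
  qed
  have "Max ?A = 3"
  proof (rule Max_eqI)
    show "finite ?A" by (rule finite_subset[OF sub]) simp
    show "a \<le> 3" if "a \<in> ?A" for a using subsetD[OF sub that] by auto
  qed (rule three)
  then show ?thesis using regularity_eq_Max[OF E] by simp
qed

end

section \<open>Lexsegments as edge sets\<close>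

lemma sqfree_pair: "c \<noteq> d \<Longrightarrow> sqfree {c, d} = X c + X d"
  by (simp add: sqfree_def)

lemma lex_less_edges_iff:
  fixes a b c d :: nat
  assumes "a < b" "c < d"
  shows "X a + X b < X c + X d \<longleftrightarrow> c < a \<or> c = a \<and> d < b"
proof -
  let ?ab = "\<lambda>k. if k = a \<or> k = b then 1 else 0 :: nat"
  let ?cd = "\<lambda>k. if k = c \<or> k = d then 1 else 0 :: nat"
  have ab: "Poly_Mapping.lookup (X a + X b) k = ?ab k" for k
    using assms lookup_sqfree[of "{a, b}" k] by (simp add: sqfree_pair)
  have cd: "Poly_Mapping.lookup (X c + X d) k = ?cd k" for k
    using assms lookup_sqfree[of "{c, d}" k] by (simp add: sqfree_pair)
  have "X a + X b < X c + X d \<longleftrightarrow> (\<exists>k. ?ab k < ?cd k \<and> (\<forall>l<k. ?ab l = ?cd l))"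
    unfolding less_monomial_iff ab cd ..
  also have "\<dots> \<longleftrightarrow> c < a \<or> c = a \<and> d < b"
  proof
    assume "\<exists>k. ?ab k < ?cd k \<and> (\<forall>l<k. ?ab l = ?cd l)"
    then obtain k where k: "?ab k < ?cd k" and below: "\<And>l. l < k \<Longrightarrow> ?ab l = ?cd l" by blast
    have k': "k \<noteq> a" "k \<noteq> b" "k = c \<or> k = d" using k by (auto split: if_splits)
    have eq: "l = a \<or> l = b \<longleftrightarrow> l = c \<or> l = d" if "l < k" for l
      using below[OF that] by (simp split: if_splits)
    from k'(3) show "c < a \<or> c = a \<and> d < b"
    proof
      assume "k = c"
      then show ?thesis using eq[of a] k'(1) assms by (cases "a < c") auto
    next
      assume "k = d"
      then have "c \<in> {a, b}" "\<not> b < d" using eq[of c] eq[of b] eq[of a] assms by auto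
      then show ?thesis using eq[of a] k' \<open>k = d\<close> assms by auto
    qed
  next
    assume "c < a \<or> c = a \<and> d < b"
    then show "\<exists>k. ?ab k < ?cd k \<and> (\<forall>l<k. ?ab l = ?cd l)"
    proof
      assume "c < a"
      then show ?thesis using assms by (intro exI[of _ c]) auto
    next
      assume "c = a \<and> d < b"
      then show ?thesis using assms by (intro exI[of _ d]) auto
    qed
  qed
  finally show ?thesis .
qed

lemma quadratic_sqfree_monomial:
  assumes "squarefree_monomial w" "mdeg w = 2"
  obtains c d where "c < d" "w = X c + X d" "Poly_Mapping.keys w = {c, d}"
proof -
  have one: "Poly_Mapping.lookup w k = (if k \<in> Poly_Mapping.keys w then 1 else 0)" for k
    using assms(1) le_antisym[of "Poly_Mapping.lookup w k" 1]
    by (auto simp: squarefree_monomial_def in_keys_iff Suc_le_eq)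
  have w: "w = sqfree (Poly_Mapping.keys w)"
    by (rule poly_mapping_eqI) (simp add: lookup_sqfree one[symmetric])
  have "card (Poly_Mapping.keys w) = 2"
    using assms(2) mdeg_sqfree[of "Poly_Mapping.keys w"] w by simp
  then obtain c' d' where "Poly_Mapping.keys w = {c', d'}" "c' \<noteq> d'"
    by (auto simp: card_2_iff)
  then obtain c d where cd: "Poly_Mapping.keys w = {c, d}" "c < d"
    by (metis insert_commute linorder_neqE_nat)
  then have "w = X c + X d" using w sqfree_pair[of c d] by simp
  with cd show thesis using that by blast
qed

lemma lexsegment_eq_segment_edges:
  assumes "1 < i" "2 \<le> j" "j < r"
  shows "lexsegment n (X 1 + X i) (X j + X r) = sqfree ` segment_edges n i j r (Suc n)"
proof -
  have le: "X c + X d \<le> X 1 + X i \<and> X j + X r \<le> X c + X d \<longleftrightarrow>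
      (1 < c \<or> c = 1 \<and> i \<le> d) \<and> (c < j \<or> c = j \<and> d \<le> r)" if "1 \<le> c" "c < d" for c d
  proof -
    have "X c + X d \<le> X 1 + X i \<and> X j + X r \<le> X c + X d \<longleftrightarrow>
        \<not> X 1 + X i < X c + X d \<and> \<not> X c + X d < X j + X r"
      by (simp only: not_less)
    also have "\<dots> \<longleftrightarrow> \<not> (c < 1 \<or> c = 1 \<and> d < i) \<and> \<not> (j < c \<or> j = c \<and> r < d)"
      unfolding lex_less_edges_iff[OF assms(1) that(2)] lex_less_edges_iff[OF that(2) assms(3)] ..
    also have "\<dots> \<longleftrightarrow> (1 < c \<or> c = 1 \<and> i \<le> d) \<and> (c < j \<or> c = j \<and> d \<le> r)"
      using that by auto
    finally show ?thesis .
  qed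
  show ?thesis
  proof (intro equalityI subsetI)
    fix w assume w: "w \<in> lexsegment n (X 1 + X i) (X j + X r)"
    then have "squarefree_monomial w" "mdeg w = 2" by (simp_all add: lexsegment_def)
    then obtain c d where cd: "c < d" "w = X c + X d" "Poly_Mapping.keys w = {c, d}"
      by (rule quadratic_sqfree_monomial)
    have bounds: "1 \<le> c" "d \<le> n"
      using w cd(3) by (auto simp: lexsegment_def monomials_def)
    have order: "(1 < c \<or> c = 1 \<and> i \<le> d) \<and> (c < j \<or> c = j \<and> d \<le> r)"
      using w unfolding cd(2) le[OF bounds(1) cd(1), symmetric] by (simp add: lexsegment_def)
    have "{c, d} \<in> segment_edges n i j r (Suc n)"
    proof (cases "c = 1")
      case True
      then have "i \<le> d \<and> d < Suc n" using order bounds by auto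
      then show ?thesis unfolding segment_edges_def True by blast
    next
      case False
      then have "2 \<le> c \<and> c < d \<and> d \<le> n \<and> (c < j \<or> c = j \<and> d < Suc r)"
        using order bounds cd(1) by auto
      then have "{c, d} \<in> initial_edges n j (Suc r)"
        unfolding initial_edges_def by blast
      then show ?thesis unfolding segment_edges_def by (rule UnI1)
    qed
    moreover have "w = sqfree {c, d}" using cd by (simp add: sqfree_pair)
    ultimately show "w \<in> sqfree ` segment_edges n i j r (Suc n)" by blast
  next
    fix w assume "w \<in> sqfree ` segment_edges n i j r (Suc n)"
    then obtain S where S: "S \<in> segment_edges n i j r (Suc n)" "w = sqfree S" by blast
    have "\<exists>c d. S = {c, d} \<and> 1 \<le> c \<and> c < d \<and> d \<le> n \<and>
        (1 < c \<or> c = 1 \<and> i \<le> d) \<and> (c < j \<or> c = j \<and> d \<le> r)"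
    proof (cases "S \<in> initial_edges n j (Suc r)")
      case True
      then obtain c d where "S = {c, d}" "2 \<le> c" "c < d" "d \<le> n" "c < j \<or> c = j \<and> d < Suc r"
        unfolding initial_edges_def by (elim CollectE exE conjE)
      then show ?thesis by - (rule exI[of _ c], rule exI[of _ d], auto)
    next
      case False
      then obtain d where "S = {1, d}" "i \<le> d" "d < Suc n"
        using S(1) unfolding segment_edges_def by auto
      then show ?thesis using assms by - (rule exI[of _ 1], rule exI[of _ d], auto)
    qed
    then obtain c d where "S = {c, d} \<and> 1 \<le> c \<and> c < d \<and> d \<le> n \<and>
        (1 < c \<or> c = 1 \<and> i \<le> d) \<and> (c < j \<or> c = j \<and> d \<le> r)"
      by (elim exE)
    then have cd: "S = {c, d}" "1 \<le> c" "c < d" "d \<le> n"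
      "(1 < c \<or> c = 1 \<and> i \<le> d) \<and> (c < j \<or> c = j \<and> d \<le> r)"
      by blast+
    have "w \<in> monomials n" "squarefree_monomial w" "mdeg w = 2"
      using cd S(2) by (auto simp: monomials_def keys_sqfree squarefree_monomial_def lookup_sqfree mdeg_sqfree)
    moreover have "w = X c + X d" using cd S(2) by (simp add: sqfree_pair)
    ultimately show "w \<in> lexsegment n (X 1 + X i) (X j + X r)"
      using le[OF cd(2,3)] cd(5) by (simp add: lexsegment_def)
  qed
qed

lemma segment_edges_bounds:
  assumes "1 < i" "2 \<le> j" "j < r" "S \<in> segment_edges n i j r (Suc n)"
  shows "S \<subseteq> {1..n}"
proof -
  have "sqfree S \<in> lexsegment n (X 1 + X i) (X j + X r)"
    unfolding lexsegment_eq_segment_edges[OF assms(1-3)] using assms(4) by (rule imageI)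
  moreover have "finite S"
    using assms(4) unfolding segment_edges_def initial_edges_def by auto
  ultimately show ?thesis
    by (simp add: lexsegment_def monomials_def keys_sqfree)
qed

lemma mono_dvd_X_iff:
  assumes "j < r" "r \<le> n"
  shows "mono_dvd (X n) (X j + X r) \<longleftrightarrow> r = n"
proof
  assume "mono_dvd (X n) (X j + X r)"
  then obtain w where "X j + X r = X n + w" by (auto simp: mono_dvd_def)
  then have "Poly_Mapping.lookup (X j + X r) n = Poly_Mapping.lookup (X n + w) n" by simp
  then show "r = n" using assms by (auto simp: X_def lookup_add lookup_single when_def split: if_splits)
next
  assume "r = n"
  then have "X j + X r = X n + X j" by (simp add: add.commute)
  then show "mono_dvd (X n) (X j + X r)" unfolding mono_dvd_def by blast
qed

section \<open>The regularity of a lexsegment edge ideal\<close>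

theorem proposition4:
  fixes n i j r :: nat
    and u v :: monomial
    and I :: "'k::field mpoly set"
  assumes "1 < i" "i \<le> n"
    and "j < r" "r \<le> n"
    and "j \<ge> 2"
    and "u = X 1 + X i"
    and "v = X j + X r"
    and "I = monomial_ideal n (lexsegment n u v)"
  shows "regularity n I = (if i \<ge> j + 2 \<and> \<not> mono_dvd (X n) v then 3 else 2)"
proof -
  interpret edge_bigrading n j .
  let ?F = "segment_edges n i j r (Suc n)"
  note bounds = segment_edges_bounds[OF assms(1,5,3)]
  have I: "I = support_ideal n ?F"
    unfolding assms(6-8) lexsegment_eq_segment_edges[OF assms(1,5,3)]
    by (rule monomial_ideal_eq_support_ideal[OF bounds])
  have dvd: "mono_dvd (X n) v \<longleftrightarrow> r = n"
    unfolding assms(7) by (rule mono_dvd_X_iff[OF assms(3,4)])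
  show ?thesis
  proof (cases "i \<ge> j + 2 \<and> r < n")
    case True
    have "almost_linearly_resolved TYPE('k) ?F (max i (Suc r) < Suc n)"
      using True assms by (intro segment_edges_almost_linearly_resolved) auto
    then have "regularity n I = 3"
      unfolding I using True assms by (intro regularity_almost_linearly_resolved) simp
    then show ?thesis using True dvd by simp
  next
    case False
    have "linearly_resolved TYPE('k) ?F"
      using False assms by (intro segment_edges_linearly_resolved) auto
    moreover have edge: "{1, i} \<in> ?F"
      using assms by (auto simp: segment_edges_def)
    ultimately have "regularity n I = 2"
      unfolding I by (rule regularity_linearly_resolved[OF _ _ bounds]) (rule edge)
    then show ?thesis using False dvd assms by auto
  qed
qed

end
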